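(* Let $C_1,c_1,\gamma>0$, let $E$ be an $m\times n$ real random matrix that is $(C_1,c_1,\gamma)$-concentrated, let $A$ be a deterministic real $m\times n$ matrix of rank $r$, and let $1\le j\le r$ be an integer. Let $V=\mathrm{Span}\{v_1,\dots,v_j\}$, $V'=\mathrm{Span}\{v_1',\dots,v_j'\}$ and $\delta_j=\sigma_j-\sigma_{j+1}$. Then, for any $t>0$, $$\sin\angle(V,V')\le4\sqrt{2j}\left(\frac{t\,r^{1/\gamma}}{\delta_j}+\frac{\|E\|^2}{\sigma_j\delta_j}+\frac{\|E\|}{\sigma_j}\right)$$ with probability at least $$1-6C_1\,9^{j}\exp\left(-c_1\frac{\delta_j^\gamma}{8^\gamma}\right)-2C_1\,9^{2r}\exp\left(-c_1r\frac{t^\gamma}{4^\gamma}\right).$$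
   Context: An $m\times n$ random matrix $E$ is $(C_1,c_1,\gamma)$-concentrated if for all unit vectors $u\in\mathbb R^m$, $v\in\mathbb R^n$ and every $t>0$, $\mathbb P(|u^{\mathrm T}Ev|>t)\le C_1\exp(-c_1t^\gamma)$. $\|\cdot\|$ is the spectral norm. $\sigma_1\ge\cdots\ge\sigma_{\min\{m,n\}}\ge0$ are the singular values of $A$ with corresponding orthonormal singular vectors $v_1,v_2,\dots$, and $\sigma_k:=0$ for $k>\min\{m,n\}$; $v_1',v_2',\dots$ are orthonormal singular vectors of $A+E$ corresponding to its singular values $\sigma_1'\ge\sigma_2'\ge\cdots$. "Singular vectors" may be read as left-singular or as right-singular, the same choice being made throughout; the result holds for either choice. For subspaces $U,V$ of the same dimension, $\sin\angle(U,V):=\max_{u\in U,u\ne0}\min_{v\in V,v\ne0}\sin\angle(u,v)=\|P_U-P_V\|=\|P_{U^\perp}P_V\|$, where $P_W$ is the orthogonal projection onto $W$ and the angle between vectors is taken in $[0,\pi/2]$. A quotient with zero denominator is read as $+\infty$. *)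

theory Defs
  imports "HOL-Probability.Probability"
begin

definition concentrated ::
  "'w measure \<Rightarrow> ('w \<Rightarrow> real^'n^'m) \<Rightarrow> real \<Rightarrow> real \<Rightarrow> real \<Rightarrow> bool" where
  "concentrated M E C c \<gamma> \<longleftrightarrow>
     (\<forall>u v t. norm u = 1 \<longrightarrow> norm v = 1 \<longrightarrow> t > 0 \<longrightarrow>
        measure M {\<omega> \<in> space M. \<bar>u \<bullet> (E \<omega> *v v)\<bar> > t} \<le> C * exp (- c * t powr \<gamma>))"

abbreviation spectral_norm :: "real^'n^'m \<Rightarrow> real" where
  "spectral_norm B \<equiv> onorm ((*v) B)"

definition orthonormal_on :: "nat set \<Rightarrow> (nat \<Rightarrow> 'a::real_inner) \<Rightarrow> bool" where
  "orthonormal_on I x \<longleftrightarrow> (\<forall>i\<in>I. \<forall>k\<in>I. x i \<bullet> x k = (if i = k then 1 else 0))"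

text \<open>
  Indices start at 1; the value of each sequence at 0, and of \<open>u\<close>, \<open>v\<close> beyond the smaller
  dimension, is irrelevant. Since one of the two orthonormal systems is a basis,
  the equations say \<open>B = (\<Sum>i. s\<^sub>i u\<^sub>i v\<^sub>i\<^sup>T)\<close>, so \<open>s\<close> lists all singular values with multiplicity,
  \<open>u\<close> are left-singular and \<open>v\<close> right-singular vectors.
\<close>
definition singular_system ::
  "real^'n^'m \<Rightarrow> (nat \<Rightarrow> real) \<Rightarrow> (nat \<Rightarrow> real^'m) \<Rightarrow> (nat \<Rightarrow> real^'n) \<Rightarrow> bool" where
  "singular_system B s u v \<longleftrightarrow>
     (let p = min CARD('m) CARD('n) in
        orthonormal_on {1..p} u \<and> orthonormal_on {1..p} v \<and>
        (\<forall>i\<in>{1..p}. B *v v i = s i *\<^sub>R u i \<and> transpose B *v u i = s i *\<^sub>R v i) \<and>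
        (\<forall>i\<in>{1..p}. \<forall>k\<in>{1..p}. i \<le> k \<longrightarrow> s k \<le> s i) \<and>
        (\<forall>i\<in>{1..p}. 0 \<le> s i) \<and>
        (\<forall>k>p. s k = 0))"

text \<open>The absolute value puts the angle in \<open>[0, \<pi>/2]\<close>.\<close>
definition vec_angle :: "'a::real_inner \<Rightarrow> 'a \<Rightarrow> real" where
  "vec_angle x y = arccos (\<bar>x \<bullet> y\<bar> / (norm x * norm y))"

text \<open>
  For nonzero finite-dimensional subspaces the supremum and infimum below are attained
  (by scaling, they range over unit spheres).
\<close>
definition sin_angle :: "'a::real_inner set \<Rightarrow> 'a set \<Rightarrow> real" where
  "sin_angle U V = (SUP x\<in>U - {0}. INF y\<in>V - {0}. sin (vec_angle x y))"

definition quot_inf :: "real \<Rightarrow> real \<Rightarrow> ereal" where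
  "quot_inf x y = (if y = 0 then \<infinity> else ereal (x / y))"

text \<open>
  The set of outcomes satisfying \<open>P\<close> need not be measurable (singular vectors of a random matrix
  may be chosen non-measurably), hence the measurable subset \<open>S\<close>. If that set is measurable,
  this is the usual bound on its probability.
\<close>
definition holds_with_prob_ge :: "'w measure \<Rightarrow> real \<Rightarrow> ('w \<Rightarrow> bool) \<Rightarrow> bool" where
  "holds_with_prob_ge M p P \<longleftrightarrow> (\<exists>S\<in>sets M. p \<le> measure M S \<and> (\<forall>\<omega>\<in>S. P \<omega>))"

end

theory Submission
  imports Defs
begin

text \<open>
  With the stated probability, two forms defined by \<open>E\<close> are small: by a
  \<open>1/4\<close>-net of the span of \<open>v\<^sub>1, \<dots>, v\<^sub>j\<close> the quadratic form \<open>x \<mapsto> W x \<bullet> E x\<close>, where \<open>W\<close> maps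
  \<open>v\<^sub>i\<close> to \<open>u\<^sub>i\<close>, is at most \<open>\<delta>/4\<close>, and by nets of the row and column space of \<open>A\<close> the
  compression of \<open>E\<close> to these spaces has norm at most \<open>\<tau>/2\<close> with \<open>\<tau> = t r\<^bsup>1/\<gamma>\<^esup>\<close>. Using the
  quadratic form instead of the full compression to the leading spaces is what costs only \<open>9\<^sup>j\<close>.

  The first estimate gives \<open>\<sigma>'\<^sub>j \<ge> \<sigma>\<^sub>j - \<delta>/4\<close> by a min-max argument. Let \<open>B = A + E\<close> and let \<open>y\<close> be
  a unit vector of \<open>V'\<close>; then \<open>y = B\<^sup>T z\<close> with \<open>z\<close> in the left space and \<open>|z| \<le> 1/\<sigma>'\<^sub>j\<close>. So the
  component of \<open>y\<close> orthogonal to the row space of \<open>A\<close>, on which only \<open>E\<close> acts, is at most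
  \<open>\<parallel>E\<parallel>/\<sigma>'\<^sub>j\<close>. Let \<open>m\<close> be the largest norm of a component along \<open>v\<^sub>j\<^sub>+\<^sub>1, \<dots>, v\<^sub>r\<close> (or along
  \<open>u\<^sub>j\<^sub>+\<^sub>1, \<dots>, u\<^sub>r\<close> on the left). Splitting \<open>z\<close> along the column space of \<open>A\<close> yields
  \<open>\<sigma>'\<^sub>j m \<le> \<sigma>\<^sub>j\<^sub>+\<^sub>1 m + \<tau>/2 + \<parallel>E\<parallel>\<^sup>2/\<sigma>'\<^sub>j\<close>, and the gap \<open>\<sigma>'\<^sub>j - \<sigma>\<^sub>j\<^sub>+\<^sub>1 \<ge> 3\<delta>/4\<close> bounds \<open>m\<close>.
\<close>

declare One_nat_def [simp del]

section \<open>Orthonormal systems and angles between subspaces\<close>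

text \<open>The coordinate formula makes linearity and self-adjointness hold for every family; it is
  the orthogonal projection onto the span when \<open>e\<close> is orthonormal on the finite set
  \<open>I\<close>.\<close>

definition ortho_proj :: "nat set \<Rightarrow> (nat \<Rightarrow> 'a::real_inner) \<Rightarrow> 'a \<Rightarrow> 'a" where
  "ortho_proj I e x = (\<Sum>i\<in>I. (x \<bullet> e i) *\<^sub>R e i)"

lemma orthonormal_on_subset: "orthonormal_on J e \<Longrightarrow> I \<subseteq> J \<Longrightarrow> orthonormal_on I e"
  unfolding orthonormal_on_def by blast

lemma orthonormal_on_inner:
  "orthonormal_on I e \<Longrightarrow> i \<in> I \<Longrightarrow> k \<in> I \<Longrightarrow> e i \<bullet> e k = (if i = k then 1 else 0)"
  by (simp add: orthonormal_on_def)

lemma orthonormal_on_nonzero: "orthonormal_on I e \<Longrightarrow> i \<in> I \<Longrightarrow> e i \<noteq> 0"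
  by (metis inner_zero_left orthonormal_on_inner zero_neq_one)

lemma inner_orthonormal_sum:
  assumes "orthonormal_on I e" "finite I" "k \<in> I"
  shows "(\<Sum>i\<in>I. a i *\<^sub>R e i) \<bullet> e k = a k"
proof -
  have "(\<Sum>i\<in>I. a i *\<^sub>R e i) \<bullet> e k = (\<Sum>i\<in>I. if i = k then a i else 0)"
    unfolding inner_sum_left using assms by (intro sum.cong) (auto simp: orthonormal_on_inner)
  then show ?thesis using assms by simp
qed

lemma inner_orthonormal_sums:
  assumes "orthonormal_on I e" "finite I"
  shows "(\<Sum>i\<in>I. a i *\<^sub>R e i) \<bullet> (\<Sum>i\<in>I. b i *\<^sub>R e i) = (\<Sum>i\<in>I. a i * b i)"
  by (subst inner_sum_right) (simp add: inner_orthonormal_sum[OF assms] mult.commute)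

lemma norm_orthonormal_sum:
  assumes "orthonormal_on I e" "finite I"
  shows "(norm (\<Sum>i\<in>I. a i *\<^sub>R e i))\<^sup>2 = (\<Sum>i\<in>I. (a i)\<^sup>2)"
  unfolding power2_norm_eq_inner inner_orthonormal_sums[OF assms] by (simp add: power2_eq_square)

lemma linear_ortho_proj: "linear (ortho_proj I e)"
  by (rule linearI)
    (simp_all add: ortho_proj_def inner_add_left scaleR_add_left sum.distrib scaleR_sum_right)

lemma ortho_proj_inner:
  assumes "orthonormal_on I e" "finite I" "k \<in> I"
  shows "ortho_proj I e x \<bullet> e k = x \<bullet> e k"
  unfolding ortho_proj_def by (rule inner_orthonormal_sum[OF assms])

lemma inner_ortho_proj_right: "y \<bullet> ortho_proj I e x = ortho_proj I e y \<bullet> x"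
  by (simp add: ortho_proj_def inner_sum_left inner_sum_right inner_commute mult.commute)

lemma ortho_proj_in_span: "ortho_proj I e x \<in> span (e ` I)"
  unfolding ortho_proj_def by (intro span_sum span_scale span_base) auto

lemma ortho_proj_of_span:
  assumes "orthonormal_on I e" "finite I" "x \<in> span (e ` I)"
  shows "ortho_proj I e x = x"
  using assms(3)
proof (induction rule: span_induct_alt)
  case base
  then show ?case by (simp add: ortho_proj_def)
next
  case (step c x y)
  then obtain k where k: "k \<in> I" "x = e k" by auto
  have "ortho_proj I e x = (\<Sum>i\<in>I. if i = k then e k else 0)"
    unfolding ortho_proj_def k(2)
    using assms k(1) by (intro sum.cong) (auto simp: orthonormal_on_inner)
  also have "\<dots> = x" using assms(2) k by simp
  finally show ?case
    using step by (simp add: linear_add[OF linear_ortho_proj] linear_scale[OF linear_ortho_proj])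
qed

lemma inner_ortho_proj_self:
  assumes "orthonormal_on I e" "finite I"
  shows "ortho_proj I e x \<bullet> x = (norm (ortho_proj I e x))\<^sup>2"
  by (metis assms inner_ortho_proj_right ortho_proj_in_span ortho_proj_of_span power2_norm_eq_inner)

lemma norm_ortho_proj:
  assumes "orthonormal_on I e" "finite I"
  shows "(norm (ortho_proj I e x))\<^sup>2 = (\<Sum>i\<in>I. (x \<bullet> e i)\<^sup>2)"
  unfolding ortho_proj_def by (rule norm_orthonormal_sum[OF assms])

lemma ortho_proj_pythagoras:
  assumes "orthonormal_on I e" "finite I"
  shows "(norm x)\<^sup>2 = (norm (ortho_proj I e x))\<^sup>2 + (norm (x - ortho_proj I e x))\<^sup>2"
  using inner_ortho_proj_self[OF assms, of x]
  by (simp add: power2_norm_eq_inner inner_diff_left inner_diff_right inner_commute)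

lemma norm_ortho_proj_le:
  assumes "orthonormal_on I e" "finite I"
  shows "norm (ortho_proj I e x) \<le> norm x"
  by (rule power2_le_imp_le) (use ortho_proj_pythagoras[OF assms, of x] in auto)

lemma orthonormal_on_independent:
  fixes e :: "nat \<Rightarrow> 'a::euclidean_space"
  assumes "orthonormal_on I e"
  shows "inj_on e I" "independent (e ` I)"
proof -
  show "inj_on e I"
    using assms by (metis inj_onI orthonormal_on_inner zero_neq_one)
  show "independent (e ` I)"
  proof (rule pairwise_orthogonal_independent)
    show "pairwise orthogonal (e ` I)"
      using assms by (auto simp: pairwise_def orthogonal_def orthonormal_on_def)
    show "0 \<notin> e ` I"
      using orthonormal_on_nonzero[OF assms] by force
  qed
qed

lemma dim_span_orthonormal:
  fixes e :: "nat \<Rightarrow> 'a::euclidean_space"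
  assumes "orthonormal_on I e"
  shows "dim (span (e ` I)) = card I"
  using orthonormal_on_independent[OF assms] by (simp add: dim_eq_card_independent card_image)

lemma ortho_proj_basis:
  fixes e :: "nat \<Rightarrow> 'a::euclidean_space"
  assumes "orthonormal_on I e" "finite I" "card I = DIM('a)"
  shows "ortho_proj I e x = x"
proof -
  have "span (e ` I) = UNIV"
    using dim_span_orthonormal[OF assms(1)] assms(3) by (simp add: dim_eq_full)
  then show ?thesis by (intro ortho_proj_of_span assms) simp
qed

text \<open>The projection to the smaller span lowers the dimension, hence kills a nonzero vector of
  the larger span.\<close>

lemma exists_orthogonal_in_span:
  fixes e f :: "nat \<Rightarrow> 'a::euclidean_space"
  assumes e: "orthonormal_on I e" and f: "orthonormal_on J f"
    and fin: "finite I" "finite J" and less: "card J < card I"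
  obtains x where "x \<in> span (e ` I)" "x \<noteq> 0" "\<And>i. i \<in> J \<Longrightarrow> x \<bullet> f i = 0"
proof -
  have "\<not> inj_on (ortho_proj J f) (span (e ` I))"
  proof
    assume "inj_on (ortho_proj J f) (span (e ` I))"
    then have "dim (ortho_proj J f ` span (e ` I)) = card I"
      using dim_image_eq[OF linear_ortho_proj, of J f "span (e ` I)"] dim_span_orthonormal[OF e]
      by (simp add: span_span)
    moreover have "dim (ortho_proj J f ` span (e ` I)) \<le> dim (span (f ` J))"
      by (rule dim_subset) (auto simp: ortho_proj_in_span)
    ultimately show False using dim_span_orthonormal[OF f] less by simp
  qed
  then obtain x where "x \<in> span (e ` I)" "x \<noteq> 0" "ortho_proj J f x = 0"
    unfolding linear_inj_on_iff_eq_0[OF linear_ortho_proj subspace_span] by blast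
  then show thesis
    using that ortho_proj_inner[OF f fin(2), of _ x] by (metis inner_zero_left)
qed

text \<open>Zero vectors are covered as well: the quotients are then read as 0 and both sides are
  1.\<close>

lemma sin_vec_angle: "sin (vec_angle x y) = sqrt (1 - (x \<bullet> y)\<^sup>2 / ((norm x)\<^sup>2 * (norm y)\<^sup>2))"
proof -
  have "\<bar>x \<bullet> y\<bar> / (norm x * norm y) \<le> 1"
    by (cases "x = 0 \<or> y = 0") (auto simp: divide_le_eq_1 Cauchy_Schwarz_ineq2)
  moreover have "-1 \<le> \<bar>x \<bullet> y\<bar> / (norm x * norm y)" by (rule order_trans[of _ 0]) simp_all
  ultimately show ?thesis
    unfolding vec_angle_def by (subst sin_arccos) (simp_all add: power_divide power_mult_distrib)
qed

text \<open>
  Equal dimensions make the one-sided estimate symmetric: once the projection of the second space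
  to the first is injective, it is onto, and each vector makes the same angle with its preimage.
\<close>
lemma sin_angle_le:
  fixes e f :: "nat \<Rightarrow> 'a::euclidean_space"
  assumes e: "orthonormal_on I e" and f: "orthonormal_on I f" and I: "finite I" "I \<noteq> {}"
    and s: "\<And>y. y \<in> span (f ` I) \<Longrightarrow> norm (y - ortho_proj I e y) \<le> s * norm y"
  shows "sin_angle (span (e ` I)) (span (f ` I)) \<le> s"
proof -
  let ?U = "span (e ` I)" and ?V = "span (f ` I)"
  obtain k where k: "k \<in> I" using I by blast
  have nz: "e k \<noteq> 0" "f k \<noteq> 0" using e f k orthonormal_on_nonzero by blast+
  have kin: "e k \<in> ?U" "f k \<in> ?V" using k by (auto intro: span_base)
  have s0: "0 \<le> s"
    using order_trans[OF norm_ge_zero s[OF kin(2)]] nz by (simp add: zero_le_mult_iff)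
  have bdd: "bdd_below ((\<lambda>y. sin (vec_angle x y)) ` (?V - {0}))" for x
    by (rule bdd_belowI[of _ "-1"]) auto
  show ?thesis
    unfolding sin_angle_def
  proof (rule cSUP_least)
    show "?U - {0} \<noteq> {}" using kin nz by blast
    fix x assume x: "x \<in> ?U - {0}"
    have "\<exists>y\<in>?V - {0}. sin (vec_angle x y) \<le> s"
    \<comment> \<open>For \<open>s \<ge> 1\<close> any nonzero vector of the second space serves, as
      a sine is at most 1.\<close>
    proof (cases "s < 1")
      case False
      then have "sin (vec_angle x (f k)) \<le> s"
        using sin_le_one[of "vec_angle x (f k)"] by linarith
      then show ?thesis using kin nz by blast
    next
      case True
      have "inj_on (ortho_proj I e) ?V"
      proof (subst linear_inj_on_iff_eq_0[OF linear_ortho_proj subspace_span], intro ballI impI)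
        fix y assume "y \<in> ?V" "ortho_proj I e y = 0"
        then have "norm y \<le> s * norm y" using s[of y] by simp
        then have "(1 - s) * norm y \<le> 0" by (simp add: algebra_simps)
        then show "y = 0" using True by (simp add: mult_le_0_iff)
      qed
      then have "dim (ortho_proj I e ` ?V) = card I"
        using dim_image_eq[OF linear_ortho_proj, of I e ?V] dim_span_orthonormal[OF f]
        by (simp add: span_span)
      then have "ortho_proj I e ` ?V = ?U"
        using dim_span_orthonormal[OF e]
        by (intro subspace_dim_equal linear_subspace_image linear_ortho_proj)
          (auto simp: ortho_proj_in_span)
      then obtain y where y: "y \<in> ?V" "x = ortho_proj I e y" using x by blast
      have y0: "y \<noteq> 0" using x y linear_0[OF linear_ortho_proj] by auto
      \<comment> \<open>As \<open>x\<close> is the projection of \<open>y\<close>,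
        \<open>x \<bullet> y\<close> is the squared norm of \<open>x\<close>, and the squared sine
        becomes the squared relative distance of \<open>y\<close> from \<open>x\<close>.\<close>
      have "1 - (x \<bullet> y)\<^sup>2 / ((norm x)\<^sup>2 * (norm y)\<^sup>2) = (norm y ^ 2 - norm x ^ 2) / (norm y)\<^sup>2"
        using x y0 inner_ortho_proj_self[OF e I(1), of y]
        by (simp add: y(2)[symmetric] inner_commute diff_divide_distrib power2_eq_square)
      also have "\<dots> = (norm (y - x))\<^sup>2 / (norm y)\<^sup>2"
        using ortho_proj_pythagoras[OF e I(1), of y] y(2) by simp
      also have "\<dots> \<le> (s * norm y)\<^sup>2 / (norm y)\<^sup>2"
        using s[OF y(1)] y(2) by (intro divide_right_mono power_mono) auto
      also have "\<dots> = s\<^sup>2" using y0 by (simp add: power_mult_distrib)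
      finally have "sin (vec_angle x y) \<le> s"
        unfolding sin_vec_angle using s0 by (simp add: real_le_lsqrt)
      then show ?thesis using y(1) y0 by blast
    qed
    then show "(INF y\<in>?V - {0}. sin (vec_angle x y)) \<le> s"
      using cINF_lower2[OF bdd] by blast
  qed
qed

section \<open>Nets on spheres of subspaces\<close>

text \<open>
  Volume comparison in the full space: the cylinders over disjoint small balls of the coordinate
  subspace lie in the cylinder over a ball of radius \<open>9/8\<close>, and stretching the
  coordinates in \<open>K\<close> by \<open>\<rho>\<close> multiplies the volume by the power \<open>card K\<close> of \<open>\<rho>\<close>.
\<close>
lemma card_separated_coordinate_sphere:
  fixes X :: "(real^'n) set" and K :: "'n set"
  assumes fin: "finite X"
    and unit: "\<And>x. x \<in> X \<Longrightarrow> norm x = 1"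
    and supp: "\<And>x i. x \<in> X \<Longrightarrow> i \<notin> K \<Longrightarrow> x $ i = 0"
    and sep: "\<And>x y. x \<in> X \<Longrightarrow> y \<in> X \<Longrightarrow> x \<noteq> y \<Longrightarrow> 1/4 < dist x y"
  shows "card X \<le> 9 ^ card K"
proof -
  define P Q :: "real^'n \<Rightarrow> real^'n"
    where "P = (\<lambda>x. \<chi> i. if i \<in> K then x $ i else 0)"
      and "Q = (\<lambda>x. \<chi> i. if i \<in> K then 0 else x $ i)"
  have Pdiff: "P (x - y) = P x - P y" and Qdiff: "Q (x - y) = Q x - Q y" for x y
    by (auto simp: P_def Q_def vec_eq_iff)
  have Px: "P x = x" and Qx: "Q x = 0" if "x \<in> X" for x
    using supp[OF that] by (auto simp: P_def Q_def vec_eq_iff)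
  have PQ: "x = P x + Q x" for x by (auto simp: P_def Q_def vec_eq_iff)
  \<comment> \<open>The unit ball in the coordinates outside \<open>K\<close> is a factor that makes
    the volume positive in the full space and cancels in the comparison.\<close>
  define Z where "Z = (\<lambda>\<rho>. {y. norm (P y) < \<rho> \<and> norm (Q y) < 1})"
  define st :: "real \<Rightarrow> real^'n \<Rightarrow> real^'n"
    where "st = (\<lambda>\<rho> x. \<chi> k. (if k \<in> K then \<rho> else 1) * x $ k)"
  have Pst: "P (st \<rho> y) = \<rho> *\<^sub>R P y" and Qst: "Q (st \<rho> y) = Q y" for \<rho> y
    by (auto simp: P_def Q_def st_def vec_eq_iff)
  have Zst: "Z \<rho> = st \<rho> ` Z 1" if "\<rho> > 0" for \<rho>
  proof
    show "st \<rho> ` Z 1 \<subseteq> Z \<rho>" using that by (auto simp: Z_def Pst Qst)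
    show "Z \<rho> \<subseteq> st \<rho> ` Z 1"
    proof
      fix y assume y: "y \<in> Z \<rho>"
      have "y = st \<rho> (st (1/\<rho>) y)" using that by (auto simp: st_def vec_eq_iff)
      moreover have "st (1/\<rho>) y \<in> Z 1" using y that by (simp add: Z_def Pst Qst field_simps)
      ultimately show "y \<in> st \<rho> ` Z 1" by blast
    qed
  qed
  have lin: "linear P" "linear Q" by (auto intro!: linearI simp: P_def Q_def vec_eq_iff)
  have cont: "continuous_on UNIV P" "continuous_on UNIV Q"
    using lin by (auto intro: linear_continuous_on simp: linear_conv_bounded_linear)
  have "open (Z 1)"
    unfolding Z_def using cont by (intro open_Collect_conj open_Collect_less continuous_intros)
  moreover have "bounded (Z 1)"
    unfolding bounded_iff
  proof (intro exI ballI)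
    fix y assume "y \<in> Z 1"
    then show "norm y \<le> 2"
      using PQ[of y] norm_triangle_ineq[of "P y" "Q y"] by (auto simp: Z_def)
  qed
  ultimately have Z1: "Z 1 \<in> lmeasurable" by (rule lmeasurable_open[rotated])
  have "0 \<in> Z 1" by (simp add: Z_def linear_0[OF lin(1)] linear_0[OF lin(2)])
  with \<open>open (Z 1)\<close> Z1 have pos: "0 < measure lebesgue (Z 1)"
    using open_not_negligible[of "Z 1"] negligible_iff_measure0[OF Z1]
    by (metis empty_iff zero_less_measure_iff)
  have Zm: "Z \<rho> \<in> lmeasurable" "measure lebesgue (Z \<rho>) = \<rho> ^ card K * measure lebesgue (Z 1)"
    if "\<rho> > 0" for \<rho>
  proof -
    have "(\<Prod>k\<in>UNIV. if k \<in> K then \<rho> else 1) = \<rho> ^ card K"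
      by (simp add: prod.If_cases)
    then show "Z \<rho> \<in> lmeasurable" "measure lebesgue (Z \<rho>) = \<rho> ^ card K * measure lebesgue (Z 1)"
      unfolding Zst[OF that] st_def
      using measurable_stretch[OF Z1] measure_stretch[OF Z1, of "\<lambda>k. if k \<in> K then \<rho> else 1"] that
      by simp_all
  qed
  \<comment> \<open>Radius \<open>1/8\<close> is half the separation, so the cylinders are disjoint,
    and added to the unit norms it gives \<open>9/8\<close>; the quotient of these radii is the base
    9.\<close>
  let ?B = "\<lambda>x. (+) x ` Z (1/8)"
  have inB: "y \<in> ?B x \<longleftrightarrow> y - x \<in> Z (1/8)" for x y
    by (auto intro: rev_image_eqI[of "y - x"])
  have Bm: "?B x \<in> lmeasurable"
    "measure lebesgue (?B x) = (1/8) ^ card K * measure lebesgue (Z 1)" for x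
    using Zm[of "1/8"] by (auto simp: measurable_translation measure_translation)
  have disj: "disjoint_family_on ?B X"
    unfolding disjoint_family_on_def
  proof (intro ballI impI)
    fix x y assume xy: "x \<in> X" "y \<in> X" "x \<noteq> y"
    have False if "z \<in> ?B x" "z \<in> ?B y" for z
    proof -
      have "norm (P z - x) < 1/8" "norm (P z - y) < 1/8"
        using that xy(1,2) unfolding inB by (auto simp: Z_def Pdiff Px)
      then have "dist x y < 1/4"
        using dist_triangle_half_l[of x "P z" "1/4" y] by (simp add: dist_norm norm_minus_commute)
      then show False using sep[OF xy] by simp
    qed
    then show "?B x \<inter> ?B y = {}" by blast
  qed
  have sub: "(\<Union>x\<in>X. ?B x) \<subseteq> Z (9/8)"
  proof
    fix z assume "z \<in> (\<Union>x\<in>X. ?B x)"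
    then obtain x where x: "x \<in> X" "z - x \<in> Z (1/8)" using inB by blast
    then show "z \<in> Z (9/8)"
      using unit[OF x(1)] norm_triangle_sub[of "P z" x] by (auto simp: Z_def Pdiff Qdiff Px Qx)
  qed
  have "(\<Sum>x\<in>X. measure lebesgue (?B x)) = measure lebesgue (\<Union>x\<in>X. ?B x)"
    using fin disj fmeasurableD[OF Bm(1)] fmeasurableD2[OF Bm(1)]
    by (intro measure_finite_Union[symmetric]) auto
  also have "\<dots> \<le> measure lebesgue (Z (9/8))"
    using sub Zm[of "9/8"] fin Bm(1)
    by (intro measure_mono_fmeasurable) (auto simp: fmeasurable_def)
  finally have "real (card X) * ((1/8) ^ card K * measure lebesgue (Z 1))
      \<le> (9/8) ^ card K * measure lebesgue (Z 1)"
    by (simp only: Bm(2) Zm(2)[of "9/8"] sum_constant)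
  then have "real (card X) * (1/8) ^ card K \<le> (9/8) ^ card K"
    using pos by simp
  then have "real (card X) \<le> 9 ^ card K"
    by (simp add: power_divide field_simps)
  then show ?thesis by (metis of_nat_le_iff of_nat_numeral of_nat_power)
qed

text \<open>A linear isometry of \<open>W\<close> onto a coordinate subspace of the same dimension
  reduces this to the coordinate case.\<close>

lemma card_separated_sphere:
  fixes X :: "(real^'n) set"
  assumes W: "subspace W" and fin: "finite X" and XW: "X \<subseteq> W"
    and unit: "\<And>x. x \<in> X \<Longrightarrow> norm x = 1"
    and sep: "\<And>x y. x \<in> X \<Longrightarrow> y \<in> X \<Longrightarrow> x \<noteq> y \<Longrightarrow> 1/4 < dist x y"
  shows "card X \<le> 9 ^ dim W"
proof -
  have "dim W \<le> CARD('n)" using dim_subset_UNIV[of W] by simp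
  then obtain K :: "'n set" where K: "card K = dim W"
    by (metis obtain_subset_with_card_n[of "dim W" UNIV])
  let ?C = "{x::real^'n. \<forall>i. i \<notin> K \<longrightarrow> x $ i = 0}"
  have C: "subspace ?C" by (auto simp: subspace_def)
  have "dim ?C = dim W" using dim_substandard_cart[of K, where 'a=real] K by (simp add: dim_vec_eq)
  then obtain f where f: "linear f" "f ` W = ?C" "\<And>x. x \<in> W \<Longrightarrow> norm (f x) = norm x"
    by (rule isometries_subspaces[OF W C, OF sym]) blast
  have dist: "dist (f x) (f y) = dist x y" if "x \<in> X" "y \<in> X" for x y
    using that XW f(3)[of "x - y"] W
    by (metis dist_norm f(1) linear_diff subsetD subspace_diff)
  then have "inj_on f X" by (metis dist_eq_0_iff inj_onI)
  then have "card X = card (f ` X)" by (simp add: card_image)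
  also have "\<dots> \<le> 9 ^ card K"
  proof (rule card_separated_coordinate_sphere)
    show "finite (f ` X)" using fin by simp
    show "norm y = 1" if "y \<in> f ` X" for y using that unit f(3) XW by auto
    show "y $ i = 0" if "y \<in> f ` X" "i \<notin> K" for y i
      using that XW f(2) by blast
    show "1/4 < dist x y" if "x \<in> f ` X" "y \<in> f ` X" "x \<noteq> y" for x y
      using that dist sep by fastforce
  qed
  finally show ?thesis using K by simp
qed

text \<open>A separated subset of the sphere with the largest cardinality is a net: a point farther
  than \<open>1/4\<close> from all its members could be added to it.\<close>

lemma exists_quarter_net:
  fixes W :: "(real^'n) set"
  assumes W: "subspace W"
  obtains N where "finite N" "card N \<le> 9 ^ dim W" "N \<subseteq> W" "\<And>x. x \<in> N \<Longrightarrow> norm x = 1"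
    "\<And>x. x \<in> W \<Longrightarrow> norm x = 1 \<Longrightarrow> \<exists>y\<in>N. dist x y \<le> 1/4"
proof -
  let ?S = "\<lambda>X. finite X \<and> X \<subseteq> W \<and> (\<forall>x\<in>X. norm x = 1) \<and> (\<forall>x\<in>X. \<forall>y\<in>X. x \<noteq> y \<longrightarrow> 1/4 < dist x y)"
  have bound: "card X \<le> 9 ^ dim W" if "?S X" for X
    using that by (intro card_separated_sphere[OF W]) auto
  \<comment> \<open>Volume comparison bounds all cardinalities, so a maximum exists;
    \<open>Suc\<close> only makes that bound strict.\<close>
  then have "\<exists>X. ?S X \<and> (\<forall>Y. ?S Y \<longrightarrow> card Y \<le> card X)"
    by (intro Lattices_Big.ex_has_greatest_nat[of ?S "{}" card "Suc (9 ^ dim W)"])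
      (simp_all add: less_Suc_eq_le)
  then obtain N where N: "?S N" and max: "\<And>Y. ?S Y \<Longrightarrow> card Y \<le> card N" by blast
  have "\<exists>y\<in>N. dist x y \<le> 1/4" if x: "x \<in> W" "norm x = 1" for x
  proof (rule ccontr)
    assume "\<not> ?thesis"
    then have far: "\<forall>y\<in>N. 1/4 < dist x y" by auto
    then have "x \<notin> N" by force
    moreover have "?S (insert x N)"
      using N x far by (auto simp: dist_commute)
    ultimately show False using max[of "insert x N"] N by simp
  qed
  then show thesis using that N bound[OF N] by blast
qed

text \<open>By polarization the maximum \<open>m\<close> of the form on the sphere also bounds the form off the
  diagonal, so moving to the net changes the value by at most \<open>m / 2\<close>.\<close>
lemma quadratic_form_net_bound:
  fixes s :: "'a::euclidean_space \<Rightarrow> 'a \<Rightarrow> real"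
  assumes s: "bounded_bilinear s" and sym: "\<And>x y. s x y = s y x"
    and W: "subspace W" and NW: "N \<subseteq> W" and unit: "\<And>x. x \<in> N \<Longrightarrow> norm x = 1"
    and net: "\<And>x. x \<in> W \<Longrightarrow> norm x = 1 \<Longrightarrow> \<exists>y\<in>N. dist x y \<le> 1/4"
    and K: "\<And>x. x \<in> N \<Longrightarrow> \<bar>s x x\<bar> \<le> K"
    and x: "x \<in> W"
  shows "\<bar>s x x\<bar> \<le> 2 * K * (norm x)\<^sup>2"
proof (cases "x = 0")
  case True
  then show ?thesis by (simp add: bounded_bilinear.zero_left[OF s])
next
  case False
  interpret bounded_bilinear s by fact
  let ?S = "W \<inter> sphere 0 1"
  have "x /\<^sub>R norm x \<in> ?S" using x W False by (simp add: subspace_scale)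
  moreover have "compact ?S" using W by (simp add: closed_subspace closed_Int_compact)
  moreover have "continuous_on ?S (\<lambda>x. \<bar>s x x\<bar>)" by (intro continuous_intros continuous_on)
  ultimately obtain w where w: "w \<in> ?S" and max: "\<And>y. y \<in> ?S \<Longrightarrow> \<bar>s y y\<bar> \<le> \<bar>s w w\<bar>"
    using continuous_attains_sup[of ?S "\<lambda>x. \<bar>s x x\<bar>"] by blast
  define m where "m = \<bar>s w w\<bar>"
  have diag: "\<bar>s y y\<bar> \<le> m * (norm y)\<^sup>2" if "y \<in> W" for y
  proof (cases "y = 0")
    case False
    then have "\<bar>s (y /\<^sub>R norm y) (y /\<^sub>R norm y)\<bar> \<le> m"
      unfolding m_def using that W by (intro max) (simp add: subspace_scale)
    then show ?thesis using False
      by (simp add: scaleR_left scaleR_right field_simps power2_eq_square abs_mult)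
  qed (simp add: zero_left)
  have off: "\<bar>s a b\<bar> \<le> m / 2 * ((norm a)\<^sup>2 + (norm b)\<^sup>2)" if "a \<in> W" "b \<in> W" for a b
  proof -
    have "4 * s a b = s (a + b) (a + b) - s (a - b) (a - b)"
      by (simp add: add_left add_right diff_left diff_right sym[of b a])
    then have "4 * \<bar>s a b\<bar> \<le> \<bar>s (a + b) (a + b)\<bar> + \<bar>s (a - b) (a - b)\<bar>" by linarith
    also have "\<dots> \<le> m * (norm (a + b))\<^sup>2 + m * (norm (a - b))\<^sup>2"
      using that W by (intro add_mono diag) (auto simp: subspace_add subspace_diff)
    also have "\<dots> = m * 2 * ((norm a)\<^sup>2 + (norm b)\<^sup>2)"
      by (simp add: power2_norm_eq_inner inner_add_left inner_add_right inner_diff_left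
          inner_diff_right inner_commute algebra_simps)
    finally show ?thesis by simp
  qed
  obtain y where y: "y \<in> N" "dist w y \<le> 1/4" using net w by auto
  have yW: "y \<in> W" and wW: "w \<in> W" using y NW w by auto
  \<comment> \<open>Both vectors lie in the unit ball because \<open>y\<close> is within
    \<open>1/4\<close> of \<open>w\<close>, and the form at them is twice the difference of the
    values at \<open>w\<close> and \<open>y\<close>; that difference is therefore at most
    \<open>m / 2\<close> in absolute value.\<close>
  let ?a = "(1/2) *\<^sub>R (w + y)" and ?b = "4 *\<^sub>R (w - y)"
  have "norm ?a \<le> 1" using norm_triangle_ineq[of w y] w unit[OF y(1)] by simp
  moreover have "norm ?b \<le> 1" using y(2) by (simp add: dist_norm)
  ultimately have "(norm ?a)\<^sup>2 + (norm ?b)\<^sup>2 \<le> 1 + 1"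
    by (intro add_mono power_le_one norm_ge_zero)
  then have "m / 2 * ((norm ?a)\<^sup>2 + (norm ?b)\<^sup>2) \<le> m / 2 * (1 + 1)"
    by (rule mult_left_mono) (simp add: m_def)
  moreover have "\<bar>s ?a ?b\<bar> \<le> m / 2 * ((norm ?a)\<^sup>2 + (norm ?b)\<^sup>2)"
    using yW wW W by (intro off subspace_scale subspace_add subspace_diff)
  moreover have "s ?a ?b = 2 * (s w w - s y y)"
    by (simp add: scaleR_left scaleR_right add_left diff_right sym[of y w] field_simps)
  ultimately have "m \<le> 2 * K" using K[OF y(1)] unfolding m_def by argo
  then have "m * (norm x)\<^sup>2 \<le> 2 * K * (norm x)\<^sup>2" by (intro mult_right_mono) auto
  with diag[OF x] show ?thesis by simp
qed

text \<open>At a maximizing pair of unit vectors, replacing the two arguments one after the other by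
  net points costs at most \<open>m / 4\<close> each, where \<open>m\<close> is the maximum; hence
  at least half of \<open>m\<close> is seen on the nets.\<close>

lemma bilinear_form_net_bound:
  fixes b :: "'a::euclidean_space \<Rightarrow> 'b::euclidean_space \<Rightarrow> real"
  assumes b: "bounded_bilinear b"
    and W1: "subspace W1" and N1: "N1 \<subseteq> W1" "\<And>x. x \<in> N1 \<Longrightarrow> norm x = 1"
    and net1: "\<And>x. x \<in> W1 \<Longrightarrow> norm x = 1 \<Longrightarrow> \<exists>y\<in>N1. dist x y \<le> 1/4"
    and W2: "subspace W2" and N2: "N2 \<subseteq> W2" "\<And>x. x \<in> N2 \<Longrightarrow> norm x = 1"
    and net2: "\<And>x. x \<in> W2 \<Longrightarrow> norm x = 1 \<Longrightarrow> \<exists>y\<in>N2. dist x y \<le> 1/4"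
    and K: "\<And>x y. x \<in> N1 \<Longrightarrow> y \<in> N2 \<Longrightarrow> \<bar>b x y\<bar> \<le> K"
    and xy: "x \<in> W1" "y \<in> W2"
  shows "\<bar>b x y\<bar> \<le> 2 * K * norm x * norm y"
proof (cases "x = 0 \<or> y = 0")
  case True
  then show ?thesis
    by (auto simp: bounded_bilinear.zero_left[OF b] bounded_bilinear.zero_right[OF b])
next
  case False
  interpret bounded_bilinear b by fact
  let ?S = "(W1 \<inter> sphere 0 1) \<times> (W2 \<inter> sphere 0 1)"
  have "(x /\<^sub>R norm x, y /\<^sub>R norm y) \<in> ?S" using xy W1 W2 False by (simp add: subspace_scale)
  moreover have "compact ?S" using W1 W2
    by (simp add: closed_subspace closed_Int_compact compact_Times)
  moreover have "continuous_on ?S (\<lambda>p. \<bar>b (fst p) (snd p)\<bar>)"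
    by (intro continuous_intros continuous_on)
  ultimately obtain p where p: "p \<in> ?S"
    and max: "\<And>q. q \<in> ?S \<Longrightarrow> \<bar>b (fst q) (snd q)\<bar> \<le> \<bar>b (fst p) (snd p)\<bar>"
    using continuous_attains_sup[of ?S "\<lambda>p. \<bar>b (fst p) (snd p)\<bar>"] by blast
  obtain w z where wz: "w \<in> W1" "norm w = 1" "z \<in> W2" "norm z = 1" "p = (w, z)" using p by auto
  define m where "m = \<bar>b w z\<bar>"
  have all: "\<bar>b a c\<bar> \<le> m * norm a * norm c" if "a \<in> W1" "c \<in> W2" for a c
  proof (cases "a = 0 \<or> c = 0")
    case False
    then have "\<bar>b (a /\<^sub>R norm a) (c /\<^sub>R norm c)\<bar> \<le> m"
      using max[of "(a /\<^sub>R norm a, c /\<^sub>R norm c)"] that W1 W2 wz(5)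
      by (simp add: subspace_scale m_def)
    then show ?thesis using False
      by (simp add: scaleR_left scaleR_right field_simps abs_mult)
  qed (auto simp: zero_left zero_right)
  obtain w' where w': "w' \<in> N1" "dist w w' \<le> 1/4" using net1 wz by blast
  obtain z' where z': "z' \<in> N2" "dist z z' \<le> 1/4" using net2 wz by blast
  have in': "w' \<in> W1" "z' \<in> W2" using w' z' N1 N2 by auto
  have m0: "0 \<le> m" by (simp add: m_def)
  have "\<bar>b (w - w') z\<bar> \<le> m * norm (w - w') * norm z"
    using in' wz W1 by (intro all) (auto simp: subspace_diff)
  also have "\<dots> \<le> m * (1/4)" using mult_left_mono[OF w'(2) m0] wz by (simp add: dist_norm)
  finally have 1: "\<bar>b (w - w') z\<bar> \<le> m * (1/4)" .
  have "\<bar>b w' (z - z')\<bar> \<le> m * norm w' * norm (z - z')"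
    using in' wz W2 by (intro all) (auto simp: subspace_diff)
  also have "\<dots> \<le> m * (1/4)"
    using mult_left_mono[OF z'(2) m0] N1(2)[OF w'(1)] by (simp add: dist_norm)
  finally have 2: "\<bar>b w' (z - z')\<bar> \<le> m * (1/4)" .
  have "b w z = b (w - w') z + b w' (z - z') + b w' z'"
    by (simp add: diff_left diff_right)
  then have "m \<le> 2 * K" using 1 2 K[OF w'(1) z'(1)] unfolding m_def by linarith
  then have "m * (norm x * norm y) \<le> 2 * K * (norm x * norm y)" by (intro mult_right_mono) auto
  with all[OF xy] show ?thesis by (simp add: mult.assoc)
qed

section \<open>Perturbation of singular subspaces\<close>

lemma inner_transpose_matrix_vector:
  fixes B :: "real^'n^'m"
  shows "x \<bullet> (transpose B *v y) = (B *v x) \<bullet> y"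
  by (metis dot_lmul_matrix inner_commute transpose_matrix_vector)

lemma transpose_add: "transpose (A + B) = transpose A + transpose (B::real^'n^'m)"
  by (simp add: transpose_def vec_eq_iff)

text \<open>Since the values vanish beyond \<open>p\<close>, monotonicity and nonnegativity extend
  to all indices from 1 on; this makes \<open>s (j + 1)\<close> usable even for
  \<open>j = p\<close>.\<close>

lemma singular_systemD:
  fixes B :: "real^'n^'m"
  assumes "singular_system B s u v" "p = min CARD('m) CARD('n)"
  shows "orthonormal_on {1..p} u" "orthonormal_on {1..p} v"
    "\<And>i. 1 \<le> i \<Longrightarrow> i \<le> p \<Longrightarrow> B *v v i = s i *\<^sub>R u i"
    "\<And>i. 1 \<le> i \<Longrightarrow> i \<le> p \<Longrightarrow> transpose B *v u i = s i *\<^sub>R v i"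
    "\<And>i k. 1 \<le> i \<Longrightarrow> i \<le> k \<Longrightarrow> s k \<le> s i"
    "\<And>i. 1 \<le> i \<Longrightarrow> 0 \<le> s i"
    "\<And>k. p < k \<Longrightarrow> s k = 0"
proof -
  have *: "orthonormal_on {1..p} u \<and> orthonormal_on {1..p} v \<and>
        (\<forall>i\<in>{1..p}. B *v v i = s i *\<^sub>R u i \<and> transpose B *v u i = s i *\<^sub>R v i) \<and>
        (\<forall>i\<in>{1..p}. \<forall>k\<in>{1..p}. i \<le> k \<longrightarrow> s k \<le> s i) \<and>
        (\<forall>i\<in>{1..p}. 0 \<le> s i) \<and> (\<forall>k>p. s k = 0)"
    using assms unfolding singular_system_def Let_def by blast
  then show "orthonormal_on {1..p} u" "orthonormal_on {1..p} v" "\<And>k. p < k \<Longrightarrow> s k = 0"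
    by blast+
  show "B *v v i = s i *\<^sub>R u i" "transpose B *v u i = s i *\<^sub>R v i" if "1 \<le> i" "i \<le> p" for i
    using * that by auto
  show nonneg: "0 \<le> s i" if "1 \<le> i" for i
    using * that by (cases "i \<le> p") auto
  show "s k \<le> s i" if "1 \<le> i" "i \<le> k" for i k
    using * that nonneg[of i] by (cases "k \<le> p") auto
qed

lemma singular_system_transpose:
  fixes B :: "real^'n^'m"
  assumes "singular_system B s u v"
  shows "singular_system (transpose B) s v u"
  using assms unfolding singular_system_def Let_def transpose_transpose min.commute[of "CARD('n)"]
  by blast

text \<open>One of the two systems is a full basis: if it is \<open>u\<close>, the image is expanded
  in it, and if it is \<open>v\<close>, the argument is. Terms past \<open>r\<close> have vanishing
  singular value.\<close>

lemma singular_system_apply: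
  fixes B :: "real^'n^'m"
  assumes B: "singular_system B s u v"
    and r: "r \<le> min CARD('m) CARD('n)" "\<And>k. r < k \<Longrightarrow> s k = 0"
  shows "B *v x = (\<Sum>i\<in>{1..r}. (s i * (x \<bullet> v i)) *\<^sub>R u i)"
proof -
  define p where "p = min CARD('m) CARD('n)"
  note sv = singular_systemD[OF B p_def]
  have "B *v x = (\<Sum>i\<in>{1..p}. (s i * (x \<bullet> v i)) *\<^sub>R u i)"
  proof (cases "CARD('m) \<le> CARD('n)")
    case True
    then have "B *v x = ortho_proj {1..p} u (B *v x)"
      by (intro ortho_proj_basis[symmetric] sv) (auto simp: p_def)
    also have "\<dots> = (\<Sum>i\<in>{1..p}. (s i * (x \<bullet> v i)) *\<^sub>R u i)"
      unfolding ortho_proj_def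
    proof (intro sum.cong refl)
      fix i assume "i \<in> {1..p}"
      then show "((B *v x) \<bullet> u i) *\<^sub>R u i = (s i * (x \<bullet> v i)) *\<^sub>R u i"
        using inner_transpose_matrix_vector[of x B "u i"] sv(4)[of i] by simp
    qed
    finally show ?thesis .
  next
    case False
    then have "x = ortho_proj {1..p} v x"
      by (intro ortho_proj_basis[symmetric] sv) (auto simp: p_def)
    then have "B *v x = B *v ortho_proj {1..p} v x" by simp
    also have "\<dots> = (\<Sum>i\<in>{1..p}. (x \<bullet> v i) *\<^sub>R (B *v v i))"
      unfolding ortho_proj_def by (simp add: linear_sum linear_scale)
    also have "\<dots> = (\<Sum>i\<in>{1..p}. (s i * (x \<bullet> v i)) *\<^sub>R u i)"
      by (intro sum.cong refl) (simp add: sv(3) mult.commute)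
    finally show ?thesis .
  qed
  also have "\<dots> = (\<Sum>i\<in>{1..r}. (s i * (x \<bullet> v i)) *\<^sub>R u i)"
    using r by (intro sum.mono_neutral_right) (auto simp: p_def)
  finally show ?thesis .
qed

text \<open>If \<open>s k\<close> were positive, \<open>u 1\<close>, ..., \<open>u k\<close> would
  be \<open>k\<close> independent vectors in the range of \<open>B\<close>.\<close>

lemma singular_value_beyond_rank:
  fixes B :: "real^'n^'m"
  assumes B: "singular_system B s u v" and k: "rank B < k"
  shows "s k = 0"
proof (rule ccontr)
  assume nz: "s k \<noteq> 0"
  define p where "p = min CARD('m) CARD('n)"
  note sv = singular_systemD[OF B p_def]
  have kp: "k \<le> p" using nz sv(7)[of k] by (meson linorder_not_le)
  have u: "orthonormal_on {1..k} u" by (rule orthonormal_on_subset[OF sv(1)]) (use kp in auto)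
  have "u ` {1..k} \<subseteq> range ((*v) B)"
  proof clarify
    fix i assume i: "i \<in> {1..k}"
    then have "s i > 0" using nz sv(5)[of i k] sv(6)[of k] by auto
    then have "u i = B *v ((1 / s i) *\<^sub>R v i)"
      using i kp sv(3)[of i] by (simp add: linear_scale)
    then show "u i \<in> range ((*v) B)" by blast
  qed
  moreover have "subspace (range ((*v) B))" by (intro linear_subspace_image) auto
  ultimately have "dim (span (u ` {1..k})) \<le> dim (range ((*v) B))"
    by (intro dim_subset span_minimal)
  then show False using dim_span_orthonormal[OF u] k by (simp add: rank_dim_range)
qed

text \<open>
  A vector of the span of \<open>v\<^sub>1, \<dots>, v\<^sub>j\<close> orthogonal to \<open>v'\<^sub>1, \<dots>, v'\<^sub>j\<^sub>-\<^sub>1\<close> is stretched by \<open>A + E\<close>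
  at most by \<open>\<sigma>'\<^sub>j\<close>.
\<close>
lemma singular_value_perturbation_lower:
  fixes A E :: "real^'n^'m"
  assumes A: "singular_system A \<sigma> u v" and B: "singular_system (A + E) \<sigma>' u' v'"
    and j: "1 \<le> j" "j \<le> min CARD('m) CARD('n)"
    and E: "\<And>x. x \<in> span (v ` {1..j}) \<Longrightarrow>
      \<bar>(\<Sum>i\<in>{1..j}. (x \<bullet> v i) *\<^sub>R u i) \<bullet> (E *v x)\<bar> \<le> \<eta> * (norm x)\<^sup>2"
  shows "\<sigma> j - \<eta> \<le> \<sigma>' j"
proof -
  define p where "p = min CARD('m) CARD('n)"
  note a = singular_systemD[OF A p_def] and b = singular_systemD[OF B p_def]
  have jp: "j \<le> p" using j p_def by simp
  have v: "orthonormal_on {1..j} v" and u: "orthonormal_on {1..j} u"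
    and v': "orthonormal_on {1..<j} v'"
    by (rule orthonormal_on_subset[OF a(2)] orthonormal_on_subset[OF a(1)]
        orthonormal_on_subset[OF b(2)]; use jp in auto)+
  obtain x where x: "x \<in> span (v ` {1..j})" "x \<noteq> 0" and orth: "\<And>i. i \<in> {1..<j} \<Longrightarrow> x \<bullet> v' i = 0"
    by (rule exists_orthogonal_in_span[OF v v']) (use j in auto)
  \<comment> \<open>\<open>w\<close> replaces each \<open>v i\<close> in \<open>x\<close> by
    \<open>u i\<close> and keeps the norm. Against it, \<open>A *v x\<close> contributes at least
    \<open>\<sigma> j\<close> and \<open>E *v x\<close> at least \<open>-\<eta>\<close> per unit of
    the squared norm of \<open>x\<close>, while their sum contributes at most
    \<open>\<sigma>' j\<close>.\<close>
  define w where "w = (\<Sum>i\<in>{1..j}. (x \<bullet> v i) *\<^sub>R u i)"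
  have nx: "(norm x)\<^sup>2 = (\<Sum>i\<in>{1..j}. (x \<bullet> v i)\<^sup>2)"
    using norm_ortho_proj[OF v, of x] ortho_proj_of_span[OF v _ x(1)] by simp
  have "(norm w)\<^sup>2 = (norm x)\<^sup>2" unfolding nx w_def by (simp add: norm_orthonormal_sum[OF u])
  then have w: "norm w = norm x" by simp
  have "(norm ((A + E) *v x))\<^sup>2 = (\<Sum>i\<in>{1..p}. (\<sigma>' i * (x \<bullet> v' i))\<^sup>2)"
    using singular_system_apply[OF B, of p x] b(7) norm_orthonormal_sum[OF b(1)]
    by (simp add: p_def)
  also have "\<dots> \<le> (\<Sum>i\<in>{1..p}. (\<sigma>' j)\<^sup>2 * (x \<bullet> v' i)\<^sup>2)"
  proof (intro sum_mono)
    fix i assume i: "i \<in> {1..p}"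
    show "(\<sigma>' i * (x \<bullet> v' i))\<^sup>2 \<le> (\<sigma>' j)\<^sup>2 * (x \<bullet> v' i)\<^sup>2"
    proof (cases "i < j")
      case True
      then show ?thesis using orth i by simp
    next
      case False
      then show ?thesis unfolding power_mult_distrib
        using i j b(5)[of j i] b(6)[of i] by (intro mult_right_mono power_mono) auto
    qed
  qed
  also have "\<dots> = (\<sigma>' j)\<^sup>2 * (norm (ortho_proj {1..p} v' x))\<^sup>2"
    by (simp add: norm_ortho_proj[OF b(2)] sum_distrib_left)
  also have "\<dots> \<le> (\<sigma>' j)\<^sup>2 * (norm x)\<^sup>2"
    by (intro mult_left_mono power_mono norm_ortho_proj_le b(2)) auto
  finally have "norm ((A + E) *v x) \<le> \<sigma>' j * norm x"
    unfolding power_mult_distrib[symmetric]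
    by (rule power2_le_imp_le) (simp add: b(6) j)
  then have "norm x * norm ((A + E) *v x) \<le> norm x * (\<sigma>' j * norm x)"
    by (rule mult_left_mono) simp
  moreover have "w \<bullet> ((A + E) *v x) \<le> norm x * norm ((A + E) *v x)"
    using norm_cauchy_schwarz[of w "(A + E) *v x"] w by simp
  ultimately have upper: "w \<bullet> ((A + E) *v x) \<le> \<sigma>' j * (norm x)\<^sup>2"
    by (simp add: power2_eq_square algebra_simps)
  have "A *v x = A *v ortho_proj {1..j} v x"
    using ortho_proj_of_span[OF v _ x(1)] by simp
  also have "\<dots> = (\<Sum>i\<in>{1..j}. (x \<bullet> v i) *\<^sub>R (A *v v i))"
    unfolding ortho_proj_def by (simp add: linear_sum linear_scale)
  also have "\<dots> = (\<Sum>i\<in>{1..j}. (\<sigma> i * (x \<bullet> v i)) *\<^sub>R u i)"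
    using jp by (intro sum.cong refl) (simp add: a(3) mult.commute)
  finally have "w \<bullet> (A *v x) = (\<Sum>i\<in>{1..j}. \<sigma> i * (x \<bullet> v i)\<^sup>2)"
    unfolding w_def by (simp add: inner_orthonormal_sums[OF u] power2_eq_square algebra_simps)
  also have "\<dots> \<ge> (\<Sum>i\<in>{1..j}. \<sigma> j * (x \<bullet> v i)\<^sup>2)"
    by (intro sum_mono mult_right_mono a(5)) auto
  finally have "\<sigma> j * (norm x)\<^sup>2 \<le> w \<bullet> (A *v x)"
    by (simp add: nx sum_distrib_left)
  moreover have "- \<eta> * (norm x)\<^sup>2 \<le> w \<bullet> (E *v x)" using E[OF x(1)] unfolding w_def by linarith
  ultimately have "(\<sigma> j - \<eta>) * (norm x)\<^sup>2 \<le> \<sigma>' j * (norm x)\<^sup>2"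
    using upper by (simp add: matrix_vector_mult_add_rdistrib inner_add_right algebra_simps)
  then show ?thesis using x(2) by (simp add: mult_le_cancel_right)
qed

section \<open>Deterministic bound for the perturbed singular subspaces\<close>

lemma linear_attains_norm_on_subspace:
  fixes f :: "'a::euclidean_space \<Rightarrow> 'b::euclidean_space"
  assumes f: "linear f" and W: "subspace W" and w: "w \<in> W" "w \<noteq> 0"
  obtains y where "y \<in> W" "norm y = 1" "\<And>x. x \<in> W \<Longrightarrow> norm (f x) \<le> norm (f y) * norm x"
proof -
  let ?S = "W \<inter> sphere 0 1"
  have "w /\<^sub>R norm w \<in> ?S" using w W by (simp add: subspace_scale)
  moreover have "compact ?S" using W by (simp add: closed_subspace closed_Int_compact)
  moreover have "continuous_on ?S (\<lambda>x. norm (f x))"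
    using f by (intro continuous_intros linear_continuous_on) (simp add: linear_conv_bounded_linear)
  ultimately obtain y where y: "y \<in> ?S" and max: "\<And>x. x \<in> ?S \<Longrightarrow> norm (f x) \<le> norm (f y)"
    using continuous_attains_sup[of ?S "\<lambda>x. norm (f x)"] by blast
  have "norm (f x) \<le> norm (f y) * norm x" if "x \<in> W" for x
  proof (cases "x = 0")
    case False
    then have "norm (f (x /\<^sub>R norm x)) \<le> norm (f y)"
      using that W by (intro max) (simp add: subspace_scale)
    then show ?thesis using False by (simp add: linear_scale[OF f] field_simps)
  qed (simp add: linear_0[OF f])
  then show thesis using that y by auto
qed

text \<open>\<open>\<epsilon>\<close> bounds all of \<open>E\<close>, and \<open>\<tau>\<close> its
  compression to the first \<open>r\<close> left and right singular directions of \<open>A\<close>.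
  The assumptions are symmetric under transposition.\<close>

locale svd_perturbation =
  fixes A E :: "real^'n^'m"
    and \<sigma> \<sigma>' :: "nat \<Rightarrow> real" and u u' :: "nat \<Rightarrow> real^'m" and v v' :: "nat \<Rightarrow> real^'n"
    and r j :: nat and \<epsilon> \<tau> :: real
  assumes A: "singular_system A \<sigma> u v" and B: "singular_system (A + E) \<sigma>' u' v'"
    and r: "r \<le> min CARD('m) CARD('n)" "\<And>k. r < k \<Longrightarrow> \<sigma> k = 0"
    and j: "1 \<le> j" "j \<le> r"
    and norm_E: "\<And>a b. \<bar>a \<bullet> (E *v b)\<bar> \<le> \<epsilon> * norm a * norm b"
    and compressed_E: "\<And>a b. a \<in> span (u ` {1..r}) \<Longrightarrow> b \<in> span (v ` {1..r}) \<Longrightarrow>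
      \<bar>a \<bullet> (E *v b)\<bar> \<le> \<tau> * norm a * norm b"
    and nonneg: "0 \<le> \<epsilon>" "0 \<le> \<tau>"
    and pos: "0 < \<sigma>' j"

text \<open>Estimates proved on the right thereby hold on the left as well, with unchanged singular
  values and constants.\<close>

lemma svd_perturbation_transpose:
  fixes A E :: "real^'n^'m"
  assumes "svd_perturbation A E \<sigma> \<sigma>' u u' v v' r j \<epsilon> \<tau>"
  shows "svd_perturbation (transpose A) (transpose E) \<sigma> \<sigma>' v v' u u' r j \<epsilon> \<tau>"
proof -
  interpret svd_perturbation A E \<sigma> \<sigma>' u u' v v' r j \<epsilon> \<tau> by fact
  have flip: "a \<bullet> (transpose E *v b) = b \<bullet> (E *v a)" for a b
    by (metis inner_commute inner_transpose_matrix_vector)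
  show ?thesis
  proof
    show "singular_system (transpose A) \<sigma> v u" by (rule singular_system_transpose[OF A])
    show "singular_system (transpose A + transpose E) \<sigma>' v' u'"
      using singular_system_transpose[OF B] by (simp add: transpose_add)
    show "\<bar>a \<bullet> (transpose E *v b)\<bar> \<le> \<epsilon> * norm a * norm b" for a b
      unfolding flip using norm_E[of b a] by (simp add: mult_ac)
    show "\<bar>a \<bullet> (transpose E *v b)\<bar> \<le> \<tau> * norm a * norm b"
      if "a \<in> span (v ` {1..r})" "b \<in> span (u ` {1..r})" for a b
      unfolding flip using compressed_E[OF that(2,1)] by (simp add: mult_ac)
  qed (use r j nonneg pos in auto)
qed

context svd_perturbation
begin

lemma orthonormal:
  assumes "I \<subseteq> {1..r}"
  shows "orthonormal_on I u" "orthonormal_on I v" "orthonormal_on I u'" "orthonormal_on I v'"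
proof -
  have "I \<subseteq> {1..min CARD('m) CARD('n)}" using assms r(1) by fastforce
  then show "orthonormal_on I u" "orthonormal_on I v" "orthonormal_on I u'" "orthonormal_on I v'"
    using singular_systemD(1,2)[OF A refl] singular_systemD(1,2)[OF B refl]
      orthonormal_on_subset by blast+
qed

text \<open>Each coefficient of \<open>y\<close> is divided by the matching singular value, which
  for indices up to \<open>j\<close> is at least \<open>\<sigma>' j > 0\<close>; the transpose of
  \<open>A + E\<close> undoes this. The last conclusion moves that transpose across the inner
  product and splits the sum.\<close>

lemma preimage:
  assumes y: "y \<in> span (v' ` {1..j})"
  obtains z where "z \<in> span (u' ` {1..j})" "norm z \<le> norm y / \<sigma>' j"
    "\<And>w. w \<bullet> y = (A *v w) \<bullet> z + (E *v w) \<bullet> z"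
proof -
  note b = singular_systemD[OF B refl]
  have on: "orthonormal_on {1..j} u'" "orthonormal_on {1..j} v'"
    using orthonormal[of "{1..j}"] j by auto
  have ge: "\<sigma>' j \<le> \<sigma>' i" if "i \<in> {1..j}" for i using b(5)[of i j] that by auto
  define z where "z = (\<Sum>i\<in>{1..j}. ((y \<bullet> v' i) / \<sigma>' i) *\<^sub>R u' i)"
  have "z \<in> span (u' ` {1..j})"
    unfolding z_def by (intro span_sum span_scale span_base) auto
  moreover have "norm z \<le> norm y / \<sigma>' j"
  proof (rule power2_le_imp_le)
    have "(norm z)\<^sup>2 = (\<Sum>i\<in>{1..j}. (y \<bullet> v' i)\<^sup>2 / (\<sigma>' i)\<^sup>2)"
      unfolding z_def by (simp add: norm_orthonormal_sum[OF on(1)] power_divide)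
    also have "\<dots> \<le> (\<Sum>i\<in>{1..j}. (y \<bullet> v' i)\<^sup>2 / (\<sigma>' j)\<^sup>2)"
      using pos ge by (intro sum_mono divide_left_mono power_mono mult_pos_pos zero_less_power)
        (auto intro: less_le_trans)
    also have "\<dots> = (norm (ortho_proj {1..j} v' y))\<^sup>2 / (\<sigma>' j)\<^sup>2"
      by (simp add: norm_ortho_proj[OF on(2)] sum_divide_distrib)
    finally show "(norm z)\<^sup>2 \<le> (norm y / \<sigma>' j)\<^sup>2"
      using ortho_proj_of_span[OF on(2) _ y] by (simp add: power_divide)
  qed (use pos in simp)
  moreover have "w \<bullet> y = (A *v w) \<bullet> z + (E *v w) \<bullet> z" for w
  proof -
    have "transpose (A + E) *v z = (\<Sum>i\<in>{1..j}. ((y \<bullet> v' i) / \<sigma>' i) *\<^sub>R (transpose (A + E) *v u' i))"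
      unfolding z_def by (simp add: linear_sum linear_scale del: transpose_matrix_vector)
    also have "\<dots> = ortho_proj {1..j} v' y"
      unfolding ortho_proj_def
    proof (intro sum.cong refl)
      fix i assume i: "i \<in> {1..j}"
      then have "transpose (A + E) *v u' i = \<sigma>' i *\<^sub>R v' i"
        using j r(1) by (intro b(4)) auto
      then show "((y \<bullet> v' i) / \<sigma>' i) *\<^sub>R (transpose (A + E) *v u' i) = (y \<bullet> v' i) *\<^sub>R v' i"
        using ge[OF i] pos by (simp del: transpose_matrix_vector)
    qed
    also have "\<dots> = y" using ortho_proj_of_span[OF on(2) _ y] by simp
    finally have "w \<bullet> y = ((A + E) *v w) \<bullet> z" using inner_transpose_matrix_vector by metis
    then show ?thesis by (simp add: matrix_vector_mult_add_rdistrib inner_add_left)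
  qed
  ultimately show thesis by (rule that)
qed

text \<open>The component orthogonal to \<open>v 1\<close>, ..., \<open>v r\<close> is annihilated
  by \<open>A\<close>, so testing \<open>y\<close> against it in \<open>preimage\<close> leaves only
  the term with \<open>E\<close>.\<close>

lemma dist_row_space:
  assumes y: "y \<in> span (v' ` {1..j})"
  shows "norm (y - ortho_proj {1..r} v y) \<le> \<epsilon> / \<sigma>' j * norm y"
proof -
  obtain z where z: "norm z \<le> norm y / \<sigma>' j" "\<And>w. w \<bullet> y = (A *v w) \<bullet> z + (E *v w) \<bullet> z"
    using preimage[OF y] by metis
  have v: "orthonormal_on {1..r} v" by (rule orthonormal) simp
  define w where "w = y - ortho_proj {1..r} v y"
  have perp: "w \<bullet> v i = 0" if "i \<in> {1..r}" for i
    using ortho_proj_inner[OF v _ that] by (simp add: w_def inner_diff_left)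
  then have Aw: "A *v w = 0" by (subst singular_system_apply[OF A r]) auto
  have "w \<bullet> ortho_proj {1..r} v y = 0" using perp by (simp add: ortho_proj_def inner_sum_right)
  then have "norm w * norm w = w \<bullet> y"
    unfolding power2_eq_square[symmetric] power2_norm_eq_inner by (simp add: w_def inner_diff_right)
  also have "\<dots> = z \<bullet> (E *v w)" using z(2)[of w] Aw by (simp add: inner_commute)
  also have "\<dots> \<le> \<epsilon> * norm z * norm w" using norm_E[of z w] by linarith
  finally have "norm w \<le> \<epsilon> * norm z"
    by (cases "w = 0") (use nonneg in auto)
  also have "\<dots> \<le> \<epsilon> * (norm y / \<sigma>' j)" using z(1) nonneg by (intro mult_left_mono)
  finally show ?thesis by (simp add: w_def)
qed

text \<open>Testing \<open>y\<close> against its own tail component \<open>w\<close> bounds the tail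
  on the right by the bound \<open>M\<close> for tails on the left.\<close>

lemma tail_projection_step:
  assumes y: "y \<in> span (v' ` {1..j})"
    and M: "\<And>z. z \<in> span (u' ` {1..j}) \<Longrightarrow> norm (ortho_proj {j+1..r} u z) \<le> M * norm z"
    and res: "\<And>z. z \<in> span (u' ` {1..j}) \<Longrightarrow>
      norm (z - ortho_proj {1..r} u z) \<le> \<epsilon> / \<sigma>' j * norm z"
    and M0: "0 \<le> M"
  shows "\<sigma>' j * norm (ortho_proj {j+1..r} v y) \<le> (\<sigma> (j + 1) * M + (\<tau> + \<epsilon>\<^sup>2 / \<sigma>' j)) * norm y"
proof -
  obtain z where z: "z \<in> span (u' ` {1..j})" "norm z \<le> norm y / \<sigma>' j"
    "\<And>w. w \<bullet> y = (A *v w) \<bullet> z + (E *v w) \<bullet> z"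
    using preimage[OF y] by metis
  note a = singular_systemD[OF A refl]
  let ?I = "{j+1..r}"
  have v: "orthonormal_on ?I v" and u: "orthonormal_on ?I u" and ur: "orthonormal_on {1..r} u"
    by (auto intro: orthonormal)
  define w where "w = ortho_proj ?I v y"
  have "A *v w = (\<Sum>i\<in>?I. (y \<bullet> v i) *\<^sub>R (A *v v i))"
    unfolding w_def ortho_proj_def by (simp add: linear_sum linear_scale)
  also have "\<dots> = (\<Sum>i\<in>?I. (\<sigma> i * (y \<bullet> v i)) *\<^sub>R u i)"
    using r(1) by (intro sum.cong refl) (simp add: a(3) mult.commute)
  finally have Aw: "A *v w = (\<Sum>i\<in>?I. (\<sigma> i * (y \<bullet> v i)) *\<^sub>R u i)" .
  \<comment> \<open>\<open>A\<close> maps the tail on the right to the tail on the left, so only the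
    tail of \<open>z\<close> is seen, and \<open>A\<close> stretches by at most
    \<open>\<sigma> (j + 1)\<close> there.\<close>
  then have "A *v w \<in> span (u ` ?I)"
    by (simp only:) (intro span_sum span_scale span_base, auto)
  then have "(A *v w) \<bullet> z = (A *v w) \<bullet> ortho_proj ?I u z"
    using ortho_proj_of_span[OF u] inner_ortho_proj_right by (metis finite_atLeastAtMost)
  also have "\<dots> \<le> norm (A *v w) * norm (ortho_proj ?I u z)" by (rule norm_cauchy_schwarz)
  also have "\<dots> \<le> (\<sigma> (j + 1) * norm w) * (M * norm z)"
  proof (intro mult_mono M z(1))
    have "(norm (A *v w))\<^sup>2 = (\<Sum>i\<in>?I. (\<sigma> i)\<^sup>2 * (y \<bullet> v i)\<^sup>2)"
      unfolding Aw by (simp add: norm_orthonormal_sum[OF u] power_mult_distrib)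
    also have "\<dots> \<le> (\<Sum>i\<in>?I. (\<sigma> (j + 1))\<^sup>2 * (y \<bullet> v i)\<^sup>2)"
      by (intro sum_mono mult_right_mono power_mono a(5) a(6)) auto
    also have "\<dots> = (\<sigma> (j + 1) * norm w)\<^sup>2"
      by (simp add: w_def power_mult_distrib norm_ortho_proj[OF v] sum_distrib_left)
    finally show "norm (A *v w) \<le> \<sigma> (j + 1) * norm w"
      by (rule power2_le_imp_le) (simp add: a(6))
  qed (simp_all add: a(6))
  finally have 1: "(A *v w) \<bullet> z \<le> \<sigma> (j + 1) * M * norm z * norm w" by (simp add: mult_ac)
  have "w \<in> span (v ` {1..r})"
    using ortho_proj_in_span[of ?I v y] span_mono[of "v ` ?I" "v ` {1..r}"]
    unfolding w_def by fastforce
  then have "ortho_proj {1..r} u z \<bullet> (E *v w) \<le> \<tau> * norm (ortho_proj {1..r} u z) * norm w"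
    using compressed_E[OF ortho_proj_in_span] abs_le_D1 by blast
  also have "\<dots> \<le> \<tau> * norm z * norm w"
    using nonneg by (intro mult_right_mono mult_left_mono norm_ortho_proj_le ur) auto
  finally have 2: "ortho_proj {1..r} u z \<bullet> (E *v w) \<le> \<tau> * norm z * norm w" .
  \<comment> \<open>The residual of \<open>z\<close> already carries one factor
    \<open>\<epsilon>\<close>, whence the square.\<close>
  have "(z - ortho_proj {1..r} u z) \<bullet> (E *v w) \<le> \<epsilon> * norm (z - ortho_proj {1..r} u z) * norm w"
    using norm_E abs_le_D1 by blast
  also have "\<dots> \<le> \<epsilon> * (\<epsilon> / \<sigma>' j * norm z) * norm w"
    using nonneg by (intro mult_right_mono mult_left_mono res z(1)) auto
  finally have 3: "(z - ortho_proj {1..r} u z) \<bullet> (E *v w) \<le> \<epsilon>\<^sup>2 / \<sigma>' j * norm z * norm w"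
    by (simp add: power2_eq_square)
  let ?c = "\<sigma> (j + 1) * M + (\<tau> + \<epsilon>\<^sup>2 / \<sigma>' j)"
  have "norm w * norm w = w \<bullet> y"
    using inner_ortho_proj_self[OF v, of y] by (simp add: w_def power2_eq_square)
  also have "\<dots> = (A *v w) \<bullet> z + ortho_proj {1..r} u z \<bullet> (E *v w)
      + (z - ortho_proj {1..r} u z) \<bullet> (E *v w)"
    unfolding z(3)[of w] by (simp add: inner_diff_left inner_commute[of "E *v w"])
  also have "\<dots> \<le> ?c * norm z * norm w" using 1 2 3 by (simp add: algebra_simps)
  finally have "norm w \<le> ?c * norm z"
    by (cases "w = 0") (use nonneg pos M0 a(6)[of "j+1"] in auto)
  also have "\<dots> \<le> ?c * (norm y / \<sigma>' j)"
    using z(2) nonneg pos M0 a(6)[of "j+1"] by (intro mult_left_mono) auto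
  finally show ?thesis using pos by (simp add: w_def field_simps)
qed

end

text \<open>The difference to the projection is split into the component off the first
  \<open>r\<close> directions and the tail. The one-step estimate couples the right and left tails,
  so their maxima are bounded together.\<close>

lemma svd_perturbation_dist:
  fixes A E :: "real^'n^'m"
  assumes loc: "svd_perturbation A E \<sigma> \<sigma>' u u' v v' r j \<epsilon> \<tau>" and gap: "\<sigma> (j + 1) < \<sigma>' j"
    and y: "y \<in> span (v' ` {1..j})"
  shows "norm (y - ortho_proj {1..j} v y)
    \<le> (\<epsilon> / \<sigma>' j + (\<tau> + \<epsilon>\<^sup>2 / \<sigma>' j) / (\<sigma>' j - \<sigma> (j + 1))) * norm y"
proof -
  interpret R: svd_perturbation A E \<sigma> \<sigma>' u u' v v' r j \<epsilon> \<tau> by fact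
  interpret L: svd_perturbation "transpose A" "transpose E" \<sigma> \<sigma>' v v' u u' r j \<epsilon> \<tau>
    by (rule svd_perturbation_transpose[OF loc])
  let ?I = "{j+1..r}" and ?f = "\<tau> + \<epsilon>\<^sup>2 / \<sigma>' j"
  have nz: "v' j \<noteq> 0" "u' j \<noteq> 0"
    using R.orthonormal(3,4)[of "{j}"] R.j by (auto dest: orthonormal_on_nonzero)
  have mem: "v' j \<in> span (v' ` {1..j})" "u' j \<in> span (u' ` {1..j})"
    using R.j by (auto intro: span_base)
  \<comment> \<open>The maximal tails are attained at unit vectors, so each can serve as the
    constant \<open>M\<close> for the opposite side.\<close>
  obtain y1 where y1: "y1 \<in> span (v' ` {1..j})" "norm y1 = 1" "\<And>x. x \<in> span (v' ` {1..j}) \<Longrightarrow>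
      norm (ortho_proj ?I v x) \<le> norm (ortho_proj ?I v y1) * norm x"
    using linear_attains_norm_on_subspace[OF linear_ortho_proj subspace_span mem(1) nz(1)] by blast
  obtain z1 where z1: "z1 \<in> span (u' ` {1..j})" "norm z1 = 1" "\<And>x. x \<in> span (u' ` {1..j}) \<Longrightarrow>
      norm (ortho_proj ?I u x) \<le> norm (ortho_proj ?I u z1) * norm x"
    using linear_attains_norm_on_subspace[OF linear_ortho_proj subspace_span mem(2) nz(2)] by blast
  define a b where "a = norm (ortho_proj ?I v y1)" and "b = norm (ortho_proj ?I u z1)"
  have ineq: "\<sigma>' j * a \<le> \<sigma> (j + 1) * b + ?f" "\<sigma>' j * b \<le> \<sigma> (j + 1) * a + ?f"
    using R.tail_projection_step[OF y1(1) z1(3) L.dist_row_space]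
      L.tail_projection_step[OF z1(1) y1(3) R.dist_row_space] y1(2) z1(2)
    by (simp_all add: a_def b_def)
  have s0: "0 \<le> \<sigma> (j + 1)" using singular_systemD(6)[OF R.A refl] by simp
  have "a \<le> ?f / (\<sigma>' j - \<sigma> (j + 1))"
  proof -
    \<comment> \<open>In the inequality for the larger of \<open>a\<close> and \<open>b\<close>, the
      smaller one is replaced by the larger and absorbed by the gap.\<close>
    have "(\<sigma>' j - \<sigma> (j + 1)) * max a b \<le> ?f"
    proof (cases "a \<le> b")
      case True
      then show ?thesis using ineq(2) mult_left_mono[OF True s0] by (simp add: algebra_simps)
    next
      case False
      then show ?thesis using ineq(1) mult_left_mono[of b a, OF _ s0] by (simp add: algebra_simps)
    qed
    moreover have "(\<sigma>' j - \<sigma> (j + 1)) * a \<le> (\<sigma>' j - \<sigma> (j + 1)) * max a b"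
      using gap by (intro mult_left_mono) auto
    ultimately have "(\<sigma>' j - \<sigma> (j + 1)) * a \<le> ?f" by linarith
    then show ?thesis using gap by (simp add: pos_le_divide_eq mult.commute)
  qed
  then have tail: "norm (ortho_proj ?I v y) \<le> ?f / (\<sigma>' j - \<sigma> (j + 1)) * norm y"
    using y1(3)[OF y] by (smt (verit) a_def mult_right_mono norm_ge_zero)
  have "{1..r} = {1..j} \<union> ?I" using R.j by auto
  then have "ortho_proj {1..r} v y = ortho_proj {1..j} v y + ortho_proj ?I v y"
    unfolding ortho_proj_def by (simp add: sum.union_disjoint)
  then have "y - ortho_proj {1..j} v y = (y - ortho_proj {1..r} v y) + ortho_proj ?I v y"
    by simp
  then have "norm (y - ortho_proj {1..j} v y)
      \<le> norm (y - ortho_proj {1..r} v y) + norm (ortho_proj ?I v y)"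
    by (metis norm_triangle_ineq)
  with tail R.dist_row_space[OF y] show ?thesis by (simp add: distrib_right)
qed

text \<open>As \<open>\<delta> \<le> \<sigma> j\<close>, losing a quarter of \<open>\<delta>\<close>
  leaves three quarters of both \<open>\<sigma> j\<close> and the gap. The resulting coefficients
  4/3, 2/3 and 16/9 stay below 4, and the root is at least 1.\<close>

lemma svd_perturbation_sin_angle:
  fixes A E :: "real^'n^'m"
  assumes loc: "svd_perturbation A E \<sigma> \<sigma>' u u' v v' r j \<epsilon> (\<tau> / 2)"
    and \<delta>: "\<delta> = \<sigma> j - \<sigma> (j + 1)" "0 < \<delta>" and gap: "\<sigma> j - \<delta> / 4 \<le> \<sigma>' j"
  shows "ereal (sin_angle (span (v ` {1..j})) (span (v' ` {1..j})))
    \<le> ereal (4 * sqrt (2 * real j)) *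
      (quot_inf \<tau> \<delta> + quot_inf (\<epsilon>\<^sup>2) (\<sigma> j * \<delta>) + quot_inf \<epsilon> (\<sigma> j))"
proof -
  interpret svd_perturbation A E \<sigma> \<sigma>' u u' v v' r j \<epsilon> "\<tau> / 2" by fact
  have s0: "0 \<le> \<sigma> (j + 1)" using singular_systemD(6)[OF A refl] by simp
  then have sj: "\<delta> \<le> \<sigma> j" "0 < \<sigma> j" using \<delta> by auto
  then have s': "3 / 4 * \<sigma> j \<le> \<sigma>' j" "3 / 4 * \<delta> \<le> \<sigma>' j - \<sigma> (j + 1)" using \<delta> gap by argo+
  have lt: "\<sigma> (j + 1) < \<sigma>' j" using s'(2) \<delta>(2) by linarith
  define D where "D = \<tau> / \<delta> + \<epsilon>\<^sup>2 / (\<sigma> j * \<delta>) + \<epsilon> / \<sigma> j"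
  have "\<epsilon> / \<sigma>' j \<le> \<epsilon> / (3 / 4 * \<sigma> j)"
    using s'(1) sj nonneg by (intro divide_left_mono mult_pos_pos) auto
  then have 1: "\<epsilon> / \<sigma>' j \<le> 4 / 3 * (\<epsilon> / \<sigma> j)" by simp
  have "\<epsilon>\<^sup>2 / \<sigma>' j \<le> \<epsilon>\<^sup>2 / (3 / 4 * \<sigma> j)"
    using s'(1) sj nonneg by (intro divide_left_mono mult_pos_pos) auto
  then have "(\<tau> / 2 + \<epsilon>\<^sup>2 / \<sigma>' j) / (\<sigma>' j - \<sigma> (j + 1))
      \<le> (\<tau> / 2 + \<epsilon>\<^sup>2 / (3 / 4 * \<sigma> j)) / (3 / 4 * \<delta>)"
    using s' sj nonneg \<delta>(2) lt by (intro frac_le) auto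
  also have "\<dots> = 2 / 3 * (\<tau> / \<delta>) + 16 / 9 * (\<epsilon>\<^sup>2 / (\<sigma> j * \<delta>))"
    using sj \<delta>(2) by (simp add: field_simps)
  finally have 2: "(\<tau> / 2 + \<epsilon>\<^sup>2 / \<sigma>' j) / (\<sigma>' j - \<sigma> (j + 1))
      \<le> 2 / 3 * (\<tau> / \<delta>) + 16 / 9 * (\<epsilon>\<^sup>2 / (\<sigma> j * \<delta>))" .
  have nn: "0 \<le> \<epsilon> / \<sigma> j" "0 \<le> \<tau> / \<delta>" "0 \<le> \<epsilon>\<^sup>2 / (\<sigma> j * \<delta>)" using nonneg sj \<delta>(2) by auto
  have "sin_angle (span (v ` {1..j})) (span (v' ` {1..j}))
      \<le> \<epsilon> / \<sigma>' j + (\<tau> / 2 + \<epsilon>\<^sup>2 / \<sigma>' j) / (\<sigma>' j - \<sigma> (j + 1))"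
    using svd_perturbation_dist[OF loc lt] j
    by (intro sin_angle_le orthonormal) auto
  also have "\<dots> \<le> 4 * D" unfolding D_def using 1 2 nn by argo
  also have "\<dots> \<le> 4 * sqrt (2 * real j) * D"
    using j nn by (intro mult_right_mono) (auto simp: D_def)
  finally show ?thesis
    using sj \<delta>(2) by (simp add: quot_inf_def D_def)
qed

section \<open>The random event and its probability\<close>

lemma borel_measurable_matrix_form:
  fixes E :: "'w \<Rightarrow> real^'n^'m"
  assumes "E \<in> borel_measurable M"
  shows "(\<lambda>\<omega>. a \<bullet> (E \<omega> *v b)) \<in> borel_measurable M"
proof -
  have "linear (\<lambda>B :: real^'n^'m. a \<bullet> (B *v b))"
    by (rule linearI)
      (simp_all add: matrix_vector_mult_add_rdistrib inner_add_right
        flip: scaleR_matrix_vector_assoc)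
  then have "continuous_on UNIV (\<lambda>B :: real^'n^'m. a \<bullet> (B *v b))"
    by (intro linear_continuous_on) (simp add: linear_conv_bounded_linear)
  from measurable_compose[OF assms borel_measurable_continuous_onI[OF this]] show ?thesis .
qed

theorem theorem18:
  fixes M :: "'w measure"
    and E :: "'w \<Rightarrow> real^'n^'m"
    and A :: "real^'n^'m"
    and C1 c1 \<gamma> t :: real
    and r j :: nat
    and \<sigma> :: "nat \<Rightarrow> real" and u :: "nat \<Rightarrow> real^'m" and v :: "nat \<Rightarrow> real^'n"
    and \<sigma>' :: "'w \<Rightarrow> nat \<Rightarrow> real" and u' :: "'w \<Rightarrow> nat \<Rightarrow> real^'m"
    and v' :: "'w \<Rightarrow> nat \<Rightarrow> real^'n"
  assumes "C1 > 0" and "c1 > 0" and "\<gamma> > 0"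
    and "prob_space M"
    and "E \<in> borel_measurable M"
    and "concentrated M E C1 c1 \<gamma>"
    and "rank A = r"
    and "1 \<le> j" and "j \<le> r"
    and "singular_system A \<sigma> u v"
    and "\<And>\<omega>. \<omega> \<in> space M \<Longrightarrow> singular_system (A + E \<omega>) (\<sigma>' \<omega>) (u' \<omega>) (v' \<omega>)"
    and "t > 0"
  shows
    "let \<delta> = \<sigma> j - \<sigma> (j + 1);
         p = 1 - 6 * C1 * 9 ^ j * exp (- c1 * (\<delta> powr \<gamma> / 8 powr \<gamma>))
               - 2 * C1 * 9 ^ (2 * r) * exp (- c1 * real r * (t powr \<gamma> / 4 powr \<gamma>));
         bound = (\<lambda>\<omega>. ereal (4 * sqrt (2 * real j)) *
                   (quot_inf (t * real r powr (1 / \<gamma>)) \<delta>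
                    + quot_inf ((spectral_norm (E \<omega>))\<^sup>2) (\<sigma> j * \<delta>)
                    + quot_inf (spectral_norm (E \<omega>)) (\<sigma> j)))
     in holds_with_prob_ge M p
          (\<lambda>\<omega>. ereal (sin_angle (span (v ` {1..j})) (span (v' \<omega> ` {1..j}))) \<le> bound \<omega>)
      \<and> holds_with_prob_ge M p
          (\<lambda>\<omega>. ereal (sin_angle (span (u ` {1..j})) (span (u' \<omega> ` {1..j}))) \<le> bound \<omega>)"
proof -
  interpret prob_space M by fact
  note A = \<open>singular_system A \<sigma> u v\<close> and j = \<open>1 \<le> j\<close> \<open>j \<le> r\<close>
  define \<delta> where "\<delta> = \<sigma> j - \<sigma> (j + 1)"
  define \<tau> where "\<tau> = t * real r powr (1 / \<gamma>)"
  define e1 e2 where "e1 = exp (- c1 * (\<delta> powr \<gamma> / 8 powr \<gamma>))"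
    and "e2 = exp (- c1 * real r * (t powr \<gamma> / 4 powr \<gamma>))"
  define p where "p = 1 - 6 * C1 * 9 ^ j * e1 - 2 * C1 * 9 ^ (2 * r) * e2"
  define bound where "bound = (\<lambda>\<omega>. ereal (4 * sqrt (2 * real j)) *
    (quot_inf \<tau> \<delta> + quot_inf ((spectral_norm (E \<omega>))\<^sup>2) (\<sigma> j * \<delta>)
      + quot_inf (spectral_norm (E \<omega>)) (\<sigma> j)))"
  have r: "r \<le> min CARD('m) CARD('n)" "\<And>k. r < k \<Longrightarrow> \<sigma> k = 0"
    using rank_bound[of A] singular_value_beyond_rank[OF A] \<open>rank A = r\<close> by auto
  note sv = singular_systemD[OF A refl]
  have \<delta>0: "0 \<le> \<delta>" using sv(5)[of j "j+1"] j by (simp add: \<delta>_def)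
  have \<tau>: "0 < \<tau>" using \<open>t > 0\<close> j by (simp add: \<tau>_def)
  \<comment> \<open>A single event is produced for the right and left singular vectors together; the
    two claims are separated only at the end.\<close>
  have "\<exists>S\<in>sets M. p \<le> measure M S \<and> (\<forall>\<omega>\<in>S.
      ereal (sin_angle (span (v ` {1..j})) (span (v' \<omega> ` {1..j}))) \<le> bound \<omega> \<and>
      ereal (sin_angle (span (u ` {1..j})) (span (u' \<omega> ` {1..j}))) \<le> bound \<omega>)"
  proof (cases "\<delta> = 0")
    case True
    \<comment> \<open>A vanishing gap makes two quotients infinite while the third is nonnegative,
      so the bound holds on the whole space.\<close>
    have nonneg: "0 \<le> spectral_norm (E \<omega>)" for \<omega> by (simp add: onorm_pos_le)
    have "bound \<omega> = \<infinity>" for \<omega>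
      using True j nonneg sv(6)[of j] by (simp add: bound_def quot_inf_def)
    moreover have "0 \<le> 6 * C1 * 9 ^ j * e1" "0 \<le> 2 * C1 * 9 ^ (2 * r) * e2"
      using \<open>C1 > 0\<close> by (simp_all add: e1_def e2_def)
    then have "p \<le> 1" unfolding p_def by linarith
    ultimately show ?thesis by (intro bexI[of _ "space M"]) (auto simp: prob_space)
  next
    case False
    then have \<delta>: "0 < \<delta>" using \<delta>0 by simp
    have sub: "{1..r} \<subseteq> {1..min CARD('m) CARD('n)}" "{1..j} \<subseteq> {1..r}" using r(1) j by auto
    have ur: "orthonormal_on {1..r} u" and vr: "orthonormal_on {1..r} v"
      using orthonormal_on_subset[OF sv(1) sub(1)] orthonormal_on_subset[OF sv(2) sub(1)] .
    have uj: "orthonormal_on {1..j} u" and vj: "orthonormal_on {1..j} v"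
      using orthonormal_on_subset[OF ur sub(2)] orthonormal_on_subset[OF vr sub(2)] .
    let ?Vj = "span (v ` {1..j})" and ?Vr = "span (v ` {1..r})" and ?Ur = "span (u ` {1..r})"
    have dims: "dim ?Vj = j" "dim ?Vr = r" "dim ?Ur = r"
      using dim_span_orthonormal[OF vj] dim_span_orthonormal[OF vr] dim_span_orthonormal[OF ur]
      by simp_all
    \<comment> \<open>\<open>N0\<close> serves the quadratic form, which depends on one vector,
      hence the exponent \<open>j\<close>; the bilinear form needs pairs from \<open>N1\<close> and
      \<open>N2\<close>, hence \<open>2 * r\<close>.\<close>
    obtain N0 where N0: "finite N0" "card N0 \<le> 9 ^ j" "N0 \<subseteq> ?Vj" "\<And>x. x \<in> N0 \<Longrightarrow> norm x = 1"
      "\<And>x. x \<in> ?Vj \<Longrightarrow> norm x = 1 \<Longrightarrow> \<exists>y\<in>N0. dist x y \<le> 1/4"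
      by (rule exists_quarter_net[of ?Vj, unfolded dims]) auto
    obtain N1 where N1: "finite N1" "card N1 \<le> 9 ^ r" "N1 \<subseteq> ?Ur" "\<And>x. x \<in> N1 \<Longrightarrow> norm x = 1"
      "\<And>x. x \<in> ?Ur \<Longrightarrow> norm x = 1 \<Longrightarrow> \<exists>y\<in>N1. dist x y \<le> 1/4"
      by (rule exists_quarter_net[of ?Ur, unfolded dims]) auto
    obtain N2 where N2: "finite N2" "card N2 \<le> 9 ^ r" "N2 \<subseteq> ?Vr" "\<And>x. x \<in> N2 \<Longrightarrow> norm x = 1"
      "\<And>x. x \<in> ?Vr \<Longrightarrow> norm x = 1 \<Longrightarrow> \<exists>y\<in>N2. dist x y \<le> 1/4"
      by (rule exists_quarter_net[of ?Vr, unfolded dims]) auto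
    define W where "W = (\<lambda>x. \<Sum>i\<in>{1..j}. (x \<bullet> v i) *\<^sub>R u i)"
    have linW: "linear W"
      by (rule linearI)
        (simp_all add: W_def inner_add_left scaleR_add_left sum.distrib scaleR_sum_right)
    have normW: "norm (W x) = norm x" if "x \<in> ?Vj" for x
    proof -
      have "(norm (W x))\<^sup>2 = (norm (ortho_proj {1..j} v x))\<^sup>2"
        unfolding W_def ortho_proj_def
        by (simp add: norm_orthonormal_sum[OF uj] norm_orthonormal_sum[OF vj])
      then show ?thesis using ortho_proj_of_span[OF vj _ that] by simp
    qed
    define bad where "bad = (\<lambda>s a b. {\<omega> \<in> space M. s < \<bar>a \<bullet> (E \<omega> *v b)\<bar>})"
    have bad_sets: "bad s a b \<in> events" for s a b
    proof -
      have "(\<lambda>\<omega>. a \<bullet> (E \<omega> *v b)) \<in> borel_measurable M"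
        by (rule borel_measurable_matrix_form) fact
      then show ?thesis unfolding bad_def by measurable
    qed
    have bad_prob: "prob (bad s a b) \<le> C1 * exp (- c1 * s powr \<gamma>)"
      if "norm a = 1" "norm b = 1" "0 < s" for s a b
      using \<open>concentrated M E C1 c1 \<gamma>\<close> that by (simp add: concentrated_def bad_def)
    \<comment> \<open>Passing from a net to the whole sphere doubles the bound, so the thresholds
      are half of what is wanted: \<open>\<delta> / 8\<close> for \<open>\<delta> / 4\<close>, and
      \<open>\<tau> / 4\<close> for \<open>\<tau> / 2\<close>.\<close>
    define F1 where "F1 = (\<Union>y\<in>N0. bad (\<delta> / 8) (W y) y)"
    define F2 where "F2 = (\<Union>q\<in>N1 \<times> N2. bad (\<tau> / 4) (fst q) (snd q))"
    have F_sets: "F1 \<in> events" "F2 \<in> events"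
      unfolding F1_def F2_def using N0(1) N1(1) N2(1) bad_sets by auto
    have "prob F1 \<le> (\<Sum>y\<in>N0. prob (bad (\<delta> / 8) (W y) y))"
      unfolding F1_def using N0(1) bad_sets by (intro finite_measure_subadditive_finite) auto
    also have "\<dots> \<le> (\<Sum>y\<in>N0. C1 * e1)"
    proof (intro sum_mono)
      fix y assume "y \<in> N0"
      then have "prob (bad (\<delta> / 8) (W y) y) \<le> C1 * exp (- c1 * (\<delta> / 8) powr \<gamma>)"
        using N0(3,4) normW \<delta> by (intro bad_prob) auto
      then show "prob (bad (\<delta> / 8) (W y) y) \<le> C1 * e1"
        using \<delta> by (simp add: e1_def powr_divide)
    qed
    also have "\<dots> \<le> 9 ^ j * (C1 * e1)"
      using of_nat_mono[OF N0(2), where 'a=real] \<open>C1 > 0\<close> by (simp add: e1_def mult_right_mono)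
    \<comment> \<open>The union bound gives coefficient 1 where the claim allows 6, and likewise 2
      for \<open>F2\<close>.\<close>
    also have "\<dots> \<le> 6 * C1 * 9 ^ j * e1" using \<open>C1 > 0\<close> by (simp add: e1_def)
    finally have F1: "prob F1 \<le> 6 * C1 * 9 ^ j * e1" .
    \<comment> \<open>The factor \<open>r powr (1 / \<gamma>)\<close> in \<open>\<tau>\<close>
      yields a factor \<open>r\<close> in the exponent, to be set against the
      \<open>9 ^ (2 * r)\<close> pairs.\<close>
    have \<tau>_powr: "(\<tau> / 4) powr \<gamma> = real r * (t powr \<gamma> / 4 powr \<gamma>)"
      using \<open>t > 0\<close> \<open>\<gamma> > 0\<close> j by (simp add: \<tau>_def powr_divide powr_mult powr_powr)
    have "prob F2 \<le> (\<Sum>q\<in>N1 \<times> N2. prob (bad (\<tau> / 4) (fst q) (snd q)))"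
      unfolding F2_def using N1(1) N2(1) bad_sets by (intro finite_measure_subadditive_finite) auto
    also have "\<dots> \<le> (\<Sum>q\<in>N1 \<times> N2. C1 * e2)"
    proof (intro sum_mono)
      fix q assume "q \<in> N1 \<times> N2"
      then have "prob (bad (\<tau> / 4) (fst q) (snd q)) \<le> C1 * exp (- c1 * (\<tau> / 4) powr \<gamma>)"
        using N1(4) N2(4) \<tau> by (intro bad_prob) auto
      then show "prob (bad (\<tau> / 4) (fst q) (snd q)) \<le> C1 * e2"
        by (simp add: e2_def \<tau>_powr mult.assoc)
    qed
    also have "\<dots> = real (card N1 * card N2) * (C1 * e2)" by (simp add: card_cartesian_product)
    also have "\<dots> \<le> real (9 ^ r * 9 ^ r) * (C1 * e2)"
      using \<open>C1 > 0\<close>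
      by (intro mult_right_mono[OF of_nat_mono[OF mult_le_mono[OF N1(2) N2(2)]]]) (simp add: e2_def)
    also have "\<dots> = 9 ^ (2 * r) * (C1 * e2)" by (simp add: mult_2 power_add)
    also have "\<dots> \<le> 2 * C1 * 9 ^ (2 * r) * e2" using \<open>C1 > 0\<close> by (simp add: e2_def)
    finally have F2: "prob F2 \<le> 2 * C1 * 9 ^ (2 * r) * e2" .
    define S where "S = space M - (F1 \<union> F2)"
    have S_sets: "S \<in> events" using F_sets by (auto simp: S_def)
    have "prob S = 1 - prob (F1 \<union> F2)" unfolding S_def using F_sets by (intro prob_compl) auto
    moreover have "prob (F1 \<union> F2) \<le> prob F1 + prob F2"
      using F_sets by (rule measure_Un_le)
    ultimately have pS: "p \<le> prob S" using F1 F2 unfolding p_def by linarith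
    have "ereal (sin_angle (span (v ` {1..j})) (span (v' \<omega> ` {1..j}))) \<le> bound \<omega> \<and>
      ereal (sin_angle (span (u ` {1..j})) (span (u' \<omega> ` {1..j}))) \<le> bound \<omega>" if \<omega>: "\<omega> \<in> S" for \<omega>
    proof -
      have \<omega>M: "\<omega> \<in> space M" using \<omega> by (simp add: S_def)
      note B = \<open>\<And>\<omega>. \<omega> \<in> space M \<Longrightarrow> singular_system (A + E \<omega>) (\<sigma>' \<omega>) (u' \<omega>) (v' \<omega>)\<close>[OF \<omega>M]
      have K1: "\<bar>W y \<bullet> (E \<omega> *v y)\<bar> \<le> \<delta> / 8" if "y \<in> N0" for y
        using \<omega> that unfolding S_def F1_def bad_def by force
      have K2: "\<bar>a \<bullet> (E \<omega> *v b)\<bar> \<le> \<tau> / 4" if "a \<in> N1" "b \<in> N2" for a b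
        using \<omega> that unfolding S_def F2_def bad_def by force
      \<comment> \<open>Polarization needs a symmetric form, and symmetrizing does not change the
        diagonal values.\<close>
      define s where "s = (\<lambda>x y. (W x \<bullet> (E \<omega> *v y) + W y \<bullet> (E \<omega> *v x)) / 2)"
      have "bilinear s"
        unfolding bilinear_def s_def
        by (auto intro!: linearI simp: linear_add[OF linW] linear_scale[OF linW] inner_add_left
            inner_add_right matrix_vector_right_distrib linear_scale field_simps)
      then have "bounded_bilinear s" by (simp add: bilinear_conv_bounded_bilinear)
      have quad: "\<bar>W x \<bullet> (E \<omega> *v x)\<bar> \<le> \<delta> / 4 * (norm x)\<^sup>2" if "x \<in> ?Vj" for x
      proof -
        have "\<bar>s x x\<bar> \<le> 2 * (\<delta> / 8) * (norm x)\<^sup>2"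
        proof (rule quadratic_form_net_bound[OF \<open>bounded_bilinear s\<close> _
                subspace_span N0(3,4,5) _ that])
          show "s x y = s y x" for x y by (simp add: s_def add.commute)
          show "\<bar>s y y\<bar> \<le> \<delta> / 8" if "y \<in> N0" for y using K1[OF that] by (simp add: s_def)
        qed
        then show ?thesis by (simp add: s_def)
      qed
      have "bilinear (\<lambda>a b. a \<bullet> (E \<omega> *v b))"
        unfolding bilinear_def
        by (auto intro!: linearI simp: inner_add_left inner_add_right matrix_vector_right_distrib
            linear_scale)
      then have bil: "bounded_bilinear (\<lambda>a b. a \<bullet> (E \<omega> *v b))"
        by (simp add: bilinear_conv_bounded_bilinear)
      have comp: "\<bar>a \<bullet> (E \<omega> *v b)\<bar> \<le> \<tau> / 2 * norm a * norm b" if "a \<in> ?Ur" "b \<in> ?Vr" for a b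
      proof -
        have "\<bar>a \<bullet> (E \<omega> *v b)\<bar> \<le> 2 * (\<tau> / 4) * norm a * norm b"
          by (rule bilinear_form_net_bound[OF bil subspace_span N1(3,4,5)
                subspace_span N2(3,4,5) K2 that])
        moreover have "2 * (\<tau> / 4) = \<tau> / 2" by simp
        ultimately show ?thesis by metis
      qed
      have gap: "\<sigma> j - \<delta> / 4 \<le> \<sigma>' \<omega> j"
        using singular_value_perturbation_lower[OF A B j(1), of "\<delta> / 4"] j(2) r(1) quad
        by (simp add: W_def)
      have loc: "svd_perturbation A (E \<omega>) \<sigma> (\<sigma>' \<omega>) u (u' \<omega>) v (v' \<omega>) r j
          (spectral_norm (E \<omega>)) (\<tau> / 2)"
      proof
        show "\<bar>a \<bullet> (E \<omega> *v b)\<bar> \<le> spectral_norm (E \<omega>) * norm a * norm b" for a b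
        proof -
          have "\<bar>a \<bullet> (E \<omega> *v b)\<bar> \<le> norm a * norm (E \<omega> *v b)" by (rule Cauchy_Schwarz_ineq2)
          also have "\<dots> \<le> norm a * (spectral_norm (E \<omega>) * norm b)"
            by (intro mult_left_mono onorm) auto
          finally show ?thesis by (simp add: mult_ac)
        qed
        show "0 \<le> spectral_norm (E \<omega>)" by (simp add: onorm_pos_le)
        \<comment> \<open>This gives \<open>\<sigma> j \<ge> \<delta>\<close>, so
          \<open>\<sigma>' \<omega> j\<close> is at least three quarters of
          \<open>\<delta>\<close>.\<close>
        have "0 \<le> \<sigma> (j + 1)" by (rule sv(6)) simp
        then show "0 < \<sigma>' \<omega> j" using gap \<delta> unfolding \<delta>_def by argo
      qed (use A B r j comp \<tau> in auto)
      \<comment> \<open>The transposed problem has the same singular values, so the same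
        \<open>gap\<close> yields the claim for left-singular vectors.\<close>
      show ?thesis
        unfolding bound_def
        using svd_perturbation_sin_angle[OF loc \<delta>_def \<delta> gap]
          svd_perturbation_sin_angle[OF svd_perturbation_transpose[OF loc] \<delta>_def \<delta> gap] by blast
    qed
    then show ?thesis using S_sets pS by blast
  qed
  then show ?thesis
    unfolding holds_with_prob_ge_def Let_def bound_def p_def e1_def e2_def \<tau>_def \<delta>_def by blast
qed

end
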